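(* Let $1\le r\le s\le t$ and $n=r+s+t+1$. Then $$n+3=r+s+t+4\le D^{f}_{2r+1}(E3C(r,s,t))\le D_{2r+2}(E3C(r,s,t))\le r+s+t+6=n+5.$$
   Context: The exchanged 3-ary $n$-cube $E3C(r,s,t)$ ($r,s,t\ge1$, $n=r+s+t+1$): vertices are strings written $x=ABCd$ with $A\in\{0,1,2\}^r$, $B\in\{0,1,2\}^s$, $C\in\{0,1,2\}^t$, $d\in\{0,1,2\}$. Two distinct vertices $x=ABCd$, $y=A'B'C'd'$ are adjacent iff one of: (E0) $A=A',B=B',C=C'$ and $d\ne d'$; (E1) $d=d'=0$, $A=A'$, $B=B'$ and $C,C'$ differ in exactly one position; (E2) $d=d'=1$, $A=A'$, $C=C'$ and $B,B'$ differ in exactly one position; (E3) $d=d'=2$, $B=B'$, $C=C'$ and $A,A'$ differ in exactly one position. For a connected graph $G$ with vertex connectivity $\kappa(G)$: the $\alpha$-fault diameter ($1\le\alpha\le\kappa(G)-1$) is $D^f_\alpha(G)=\max\{d_{G-F}(u,v): u\ne v,\ F\subseteq V(G)\setminus\{u,v\},\ |F|=\alpha\}$; the $\beta$-wide diameter ($1\le\beta\le\kappa(G)$) $D_\beta(G)$ is the maximum over distinct $u,v$ of the minimum, over all families of $\beta$ pairwise internally disjoint $u$–$v$ paths, of the maximum length of a path in the family. (It is known that $\kappa(E3C(r,s,t))=2r+2$ when $r\le s\le t$.) *)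

theory Defs
  imports Main "HOL-Library.Extended_Nat"
begin

definition gpath :: "'a set \<Rightarrow> ('a \<Rightarrow> 'a \<Rightarrow> bool) \<Rightarrow> 'a list \<Rightarrow> 'a \<Rightarrow> 'a \<Rightarrow> bool" where
  "gpath V E p u v \<longleftrightarrow> p \<noteq> [] \<and> hd p = u \<and> last p = v \<and> distinct p \<and> set p \<subseteq> V \<and>
      (\<forall>i. i + 1 < length p \<longrightarrow> E (p ! i) (p ! (i + 1)))"

definition plen :: "'a list \<Rightarrow> nat" where
  "plen p = length p - 1"

text \<open>Distance in the subgraph induced by V (infinite if no path).\<close>
definition gdist :: "'a set \<Rightarrow> ('a \<Rightarrow> 'a \<Rightarrow> bool) \<Rightarrow> 'a \<Rightarrow> 'a \<Rightarrow> enat" where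
  "gdist V E u v = Inf {enat (plen p) | p. gpath V E p u v}"

definition fault_diam :: "'a set \<Rightarrow> ('a \<Rightarrow> 'a \<Rightarrow> bool) \<Rightarrow> nat \<Rightarrow> enat" where
  "fault_diam V E \<alpha> = Sup {gdist (V - F) E u v | u v F.
      u \<in> V \<and> v \<in> V \<and> u \<noteq> v \<and> F \<subseteq> V - {u, v} \<and> finite F \<and> card F = \<alpha>}"

definition disj_paths :: "'a set \<Rightarrow> ('a \<Rightarrow> 'a \<Rightarrow> bool) \<Rightarrow> nat \<Rightarrow> 'a \<Rightarrow> 'a \<Rightarrow> 'a list set \<Rightarrow> bool" where
  "disj_paths V E \<beta> u v P \<longleftrightarrow> finite P \<and> card P = \<beta> \<and> (\<forall>p\<in>P. gpath V E p u v) \<and>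
      (\<forall>p\<in>P. \<forall>q\<in>P. p \<noteq> q \<longrightarrow> set p \<inter> set q \<subseteq> {u, v})"

definition wide_diam :: "'a set \<Rightarrow> ('a \<Rightarrow> 'a \<Rightarrow> bool) \<Rightarrow> nat \<Rightarrow> enat" where
  "wide_diam V E \<beta> = Sup {Inf {Sup ((\<lambda>p. enat (plen p)) ` P) | P. disj_paths V E \<beta> u v P} | u v.
      u \<in> V \<and> v \<in> V \<and> u \<noteq> v}"

definition tern_words :: "nat \<Rightarrow> nat list set" where
  "tern_words k = {xs. length xs = k \<and> set xs \<subseteq> {0, 1, 2}}"

text \<open>Vertex ABCd is represented as the tuple (A, B, C, d).\<close>
type_synonym e3c_vertex = "nat list \<times> nat list \<times> nat list \<times> nat"

definition E3C_V :: "nat \<Rightarrow> nat \<Rightarrow> nat \<Rightarrow> e3c_vertex set" where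
  "E3C_V r s t = {(A, B, C, d). A \<in> tern_words r \<and> B \<in> tern_words s \<and> C \<in> tern_words t \<and> d \<in> {0, 1, 2}}"

definition differ_one :: "nat list \<Rightarrow> nat list \<Rightarrow> bool" where
  "differ_one X Y \<longleftrightarrow> length X = length Y \<and> card {i. i < length X \<and> X ! i \<noteq> Y ! i} = 1"

definition E3C_E :: "e3c_vertex \<Rightarrow> e3c_vertex \<Rightarrow> bool" where
  "E3C_E x y \<longleftrightarrow> (case (x, y) of ((A, B, C, d), (A', B', C', d')) \<Rightarrow>
      x \<noteq> y \<and>
      ((A = A' \<and> B = B' \<and> C = C' \<and> d \<noteq> d') \<or>
       (d = 0 \<and> d' = 0 \<and> A = A' \<and> B = B' \<and> differ_one C C') \<or>
       (d = 1 \<and> d' = 1 \<and> A = A' \<and> C = C' \<and> differ_one B B') \<or>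
       (d = 2 \<and> d' = 2 \<and> B = B' \<and> C = C' \<and> differ_one A A')))"

end

theory Submission
  imports Defs
begin

text \<open>
  Lower bound: let \<open>u\<close> and \<open>v\<close> lie in layer 2 and differ in every position, and delete all
  neighbours of \<open>u\<close> except one, \<open>w\<close>, that also differs from \<open>v\<close> in every position. Every path from
  \<open>w\<close> to \<open>v\<close> corrects \<open>r + s + t\<close> positions and changes the layer three times.

  Middle inequality: \<open>2r + 1\<close> faults meet at most \<open>2r + 1\<close> of \<open>2r + 2\<close> internally disjoint paths.

  Upper bound: up to permuting the three words and reversing paths, \<open>u = (A, B, C, 2)\<close> and
  \<open>v = (A', B', C', d)\<close> with \<open>d\<close> 2 or 1. It suffices to confine paths to pairwise disjoint vertex
  sets. For \<open>d = 2\<close> a path starts at each neighbour \<open>P\<close> of \<open>A\<close>, carries \<open>P\<close> along while it corrects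
  \<open>B\<close> and then \<open>C\<close>, and finishes in a fan from the neighbours of \<open>A\<close> to \<open>A'\<close> in the ternary Hamming
  graph. For \<open>d = 1\<close> neighbours \<open>P\<close> of \<open>A\<close> are matched with neighbours \<open>Q\<close> of \<open>B'\<close>; a path corrects
  \<open>B\<close> to \<open>Q\<close> beside \<open>P\<close>, then \<open>C\<close>, and then \<open>P\<close> to \<open>A'\<close> beside \<open>Q\<close>. The remaining one or two paths
  make a detour through a third or second word different from both end values.
\<close>

section \<open>Distance and wide distance\<close>

lemma gpath_iff_successively:
  "gpath V E p u v \<longleftrightarrow>
     p \<noteq> [] \<and> hd p = u \<and> last p = v \<and> distinct p \<and> set p \<subseteq> V \<and> successively E p"
  by (simp add: gpath_def successively_conv_nth)

lemma gpath_Nil [simp]: "\<not> gpath V E [] u v"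
  by (simp add: gpath_def)

lemma gpath_Cons:
  "gpath V E (a # p) u v \<longleftrightarrow> u = a \<and> a \<in> V \<and>
     (if p = [] then v = a else a \<notin> set p \<and> E a (hd p) \<and> gpath V E p (hd p) v)"
  by (auto simp: gpath_iff_successively successively_Cons)

lemma gpath_append_ConsD: "gpath V E (p @ a # q) u v \<Longrightarrow> gpath V E (a # q) a v"
  by (auto simp: gpath_iff_successively successively_append_iff)

lemma gpath_mono: "gpath V E p u v \<Longrightarrow> V \<subseteq> W \<Longrightarrow> gpath W E p u v"
  by (auto simp: gpath_def)

lemma gpath_map:
  assumes "gpath V E p u v" "inj_on f V" "f ` V \<subseteq> W"
    and "\<And>x y. x \<in> V \<Longrightarrow> y \<in> V \<Longrightarrow> E x y \<Longrightarrow> E' (f x) (f y)"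
  shows "gpath W E' (map f p) (f u) (f v)"
proof -
  have p: "p \<noteq> []" "hd p = u" "last p = v" "distinct p" "set p \<subseteq> V" "successively E p"
    using assms(1) by (auto simp: gpath_iff_successively)
  have "successively E' (map f p)"
    unfolding successively_map by (rule successively_mono[OF p(6)]) (use assms(4) p(5) in blast)
  moreover have "inj_on f (set p)" using assms(2) p(5) by (rule inj_on_subset)
  ultimately show ?thesis
    using p assms(3) by (auto simp: gpath_iff_successively hd_map last_map distinct_map)
qed

lemma gpath_rev:
  assumes "gpath V E p u v" and "\<And>x y. E x y \<Longrightarrow> E y x"
  shows "gpath V E (rev p) v u"
  using assms by (auto simp: gpath_iff_successively hd_rev last_rev intro: successively_mono)

lemma plen_map [simp]: "plen (map f p) = plen p"
  by (simp add: plen_def)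

lemma plen_rev [simp]: "plen (rev p) = plen p"
  by (simp add: plen_def)

lemma plen_Cons: "p \<noteq> [] \<Longrightarrow> plen (a # p) = Suc (plen p)"
  by (simp add: plen_def)

lemma gdist_le_plen: "gpath V E p u v \<Longrightarrow> gdist V E u v \<le> enat (plen p)"
  unfolding gdist_def by (auto intro: Inf_lower)

lemma gdist_lessE:
  assumes "gdist V E u v < enat k"
  obtains p where "gpath V E p u v" "plen p < k"
  using assms unfolding gdist_def by (auto simp: Inf_less_iff)

lemma gdist_leE:
  assumes "gdist V E u v \<le> enat k"
  obtains p where "gpath V E p u v" "plen p \<le> k"
proof -
  have "gdist V E u v < enat (Suc k)" using assms by (simp add: le_less_trans)
  then show ?thesis by (rule gdist_lessE) (simp add: that)
qed

lemma gdist_geI: "(\<And>p. gpath V E p u v \<Longrightarrow> d \<le> enat (plen p)) \<Longrightarrow> d \<le> gdist V E u v"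
  unfolding gdist_def by (auto intro: Inf_greatest)

lemma gdist_antimono: "V \<subseteq> W \<Longrightarrow> gdist W E u v \<le> gdist V E u v"
  by (blast intro: gdist_geI gdist_le_plen gpath_mono)

lemma gdist_self: "v \<in> V \<Longrightarrow> gdist V E v v = 0"
  using gdist_le_plen[of V E "[v]" v v] by (simp add: gpath_Cons plen_def flip: zero_enat_def)

lemma gdist_image_le:
  assumes "inj_on f V" "f ` V \<subseteq> W" "\<And>x y. x \<in> V \<Longrightarrow> y \<in> V \<Longrightarrow> E x y \<Longrightarrow> E' (f x) (f y)"
  shows "gdist W E' (f u) (f v) \<le> gdist V E u v"
proof (rule gdist_geI)
  fix p assume "gpath V E p u v"
  from gdist_le_plen[OF gpath_map[where E' = E', OF this assms]]
  show "gdist W E' (f u) (f v) \<le> enat (plen p)" by simp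
qed

lemma gdist_le_eSuc_gdist_neighbour:
  assumes "a \<in> V" "E a b"
  shows "gdist V E a c \<le> eSuc (gdist V E b c)"
proof (cases "gdist V E b c")
  case (enat k)
  then obtain p where p: "gpath V E p b c" "plen p \<le> k" by (elim gdist_leE[OF eq_refl])
  have "\<exists>q. gpath V E q a c \<and> plen q \<le> Suc (plen p)"
  proof (cases "a \<in> set p")
    case True
    then obtain q r where "p = q @ a # r" by (auto dest: split_list)
    with p(1) have "gpath V E (a # r) a c" "plen (a # r) \<le> Suc (plen p)"
      by (auto intro: gpath_append_ConsD simp: plen_def)
    then show ?thesis by blast
  next
    case False
    have "p \<noteq> []" "hd p = b" using p(1) by (auto simp: gpath_def)
    moreover from this have "gpath V E (a # p) a c" using False assms p(1) by (simp add: gpath_Cons)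
    ultimately show ?thesis using plen_Cons by (metis order_refl)
  qed
  then obtain q where q: "gpath V E q a c" "plen q \<le> Suc (plen p)" by blast
  have "gdist V E a c \<le> enat (plen q)" using q(1) by (rule gdist_le_plen)
  also have "\<dots> \<le> enat (Suc k)" using q(2) p(2) by simp
  finally show ?thesis using enat by (simp add: eSuc_enat)
qed simp

lemma potential_le_gdist:
  fixes h :: "'a \<Rightarrow> enat"
  assumes "\<And>x y. x \<in> V \<Longrightarrow> y \<in> V \<Longrightarrow> E x y \<Longrightarrow> h x \<le> eSuc (h y)"
  shows "h u \<le> gdist V E u v + h v"
proof (cases "gdist V E u v")
  case (enat k)
  then obtain p where p: "gpath V E p u v" "plen p \<le> k" by (elim gdist_leE[OF eq_refl])
  have "h u \<le> enat (plen p) + h v"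
    using p(1)
  proof (induction p arbitrary: u)
    case (Cons x p)
    show ?case
    proof (cases "p = []")
      case False
      then have p: "u \<in> V" "E u (hd p)" "gpath V E p (hd p) v"
        using Cons.prems by (auto simp: gpath_Cons)
      then have "hd p \<in> V" by (auto simp: gpath_def)
      then have "h u \<le> eSuc (h (hd p))" using p by (intro assms)
      also have "\<dots> \<le> eSuc (enat (plen p) + h v)" using Cons.IH[OF p(3)] by simp
      finally show ?thesis using False by (simp add: plen_Cons iadd_Suc flip: eSuc_enat)
    qed (use Cons.prems in \<open>simp add: gpath_Cons\<close>)
  qed simp
  also have "\<dots> \<le> enat k + h v" using p(2) by (intro add_right_mono) simp
  finally show ?thesis using enat by simp
qed simp

lemma gdist_triangle: "gdist V E a c \<le> gdist V E a b + gdist V E b c"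
  by (rule potential_le_gdist) (rule gdist_le_eSuc_gdist_neighbour)

lemma gdist_triangle_le:
  "gdist V E a b \<le> enat k \<Longrightarrow> gdist V E b c \<le> enat l \<Longrightarrow> gdist V E a c \<le> enat (k + l)"
  using order_trans[OF gdist_triangle add_mono] by (simp flip: plus_enat_simps(1))

lemma gdist_edge_le: "u \<in> V \<Longrightarrow> v \<in> V \<Longrightarrow> E u v \<Longrightarrow> gdist V E u v \<le> enat 1"
  using gdist_le_eSuc_gdist_neighbour[of u V E v v]
  by (simp add: gdist_self eSuc_enat zero_enat_def)

lemma gdist_via_sole_neighbour_le:
  assumes "u \<noteq> v" and sole: "\<And>y. y \<in> V \<Longrightarrow> E u y \<Longrightarrow> y = w"
  shows "eSuc (gdist V E w v) \<le> gdist V E u v"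
proof (rule gdist_geI)
  fix p assume "gpath V E p u v"
  then obtain q where q: "p = u # q" "q \<noteq> []" "E u (hd q)" "gpath V E q (hd q) v"
    using assms(1) by (cases p) (auto simp: gpath_Cons split: if_splits)
  then have "hd q = w" by (intro sole) (auto simp: gpath_def)
  then have "gdist V E w v \<le> enat (plen q)" using q(4) gdist_le_plen by metis
  then have "eSuc (gdist V E w v) \<le> eSuc (enat (plen q))" by simp
  then show "eSuc (gdist V E w v) \<le> enat (plen p)"
    using q(1,2) by (simp add: plen_Cons eSuc_enat)
qed

definition wide_dist :: "'a set \<Rightarrow> ('a \<Rightarrow> 'a \<Rightarrow> bool) \<Rightarrow> nat \<Rightarrow> 'a \<Rightarrow> 'a \<Rightarrow> enat" where
  "wide_dist V E \<beta> u v = Inf {Sup ((\<lambda>p. enat (plen p)) ` P) |P. disj_paths V E \<beta> u v P}"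

lemma wide_diam_eq_Sup_wide_dist:
  "wide_diam V E \<beta> = Sup {wide_dist V E \<beta> u v |u v. u \<in> V \<and> v \<in> V \<and> u \<noteq> v}"
  by (simp add: wide_diam_def wide_dist_def)

lemma wide_diam_leI:
  "(\<And>u v. u \<in> V \<Longrightarrow> v \<in> V \<Longrightarrow> u \<noteq> v \<Longrightarrow> wide_dist V E \<beta> u v \<le> k) \<Longrightarrow> wide_diam V E \<beta> \<le> k"
  unfolding wide_diam_eq_Sup_wide_dist by (rule Sup_least) blast

lemma wide_dist_leI:
  assumes "disj_paths V E n u v P" "\<And>p. p \<in> P \<Longrightarrow> plen p \<le> k"
  shows "wide_dist V E n u v \<le> enat k"
  unfolding wide_dist_def
  by (rule Inf_lower2[of "Sup ((\<lambda>p. enat (plen p)) ` P)"]) (use assms in \<open>auto intro!: Sup_least\<close>)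

lemma wide_dist_le_wide_distI:
  assumes "\<And>P. disj_paths W E' m x y P \<Longrightarrow> \<exists>Q. disj_paths V E n u v Q \<and> plen ` Q \<subseteq> plen ` P"
  shows "wide_dist V E n u v \<le> wide_dist W E' m x y"
  unfolding wide_dist_def[of W]
proof (rule Inf_greatest, clarify)
  fix P assume "disj_paths W E' m x y P"
  then obtain Q where Q: "disj_paths V E n u v Q" "plen ` Q \<subseteq> plen ` P" using assms by blast
  have "wide_dist V E n u v \<le> Sup (enat ` plen ` Q)"
    unfolding wide_dist_def by (rule Inf_lower) (use Q(1) in \<open>auto simp: image_image\<close>)
  also have "\<dots> \<le> Sup (enat ` plen ` P)" using Q(2) by (intro Sup_subset_mono image_mono)
  finally show "wide_dist V E n u v \<le> Sup ((\<lambda>p. enat (plen p)) ` P)" by (simp add: image_image)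
qed

lemma disj_paths_subset: "disj_paths V E n u v P \<Longrightarrow> Q \<subseteq> P \<Longrightarrow> disj_paths V E (card Q) u v Q"
  unfolding disj_paths_def by (meson finite_subset subsetD)

lemma wide_dist_mono:
  assumes "m \<le> n"
  shows "wide_dist V E m u v \<le> wide_dist V E n u v"
proof (rule wide_dist_le_wide_distI)
  fix P assume P: "disj_paths V E n u v P"
  then have "m \<le> card P" using assms by (simp add: disj_paths_def)
  then obtain Q where "Q \<subseteq> P" "card Q = m" by (rule obtain_subset_with_card_n)
  then show "\<exists>Q. disj_paths V E m u v Q \<and> plen ` Q \<subseteq> plen ` P"
    using disj_paths_subset[OF P] by blast
qed

lemma disj_paths_map:
  assumes P: "disj_paths V E n u v P" and f: "inj_on f V" "f ` V \<subseteq> W"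
    and E: "\<And>x y. x \<in> V \<Longrightarrow> y \<in> V \<Longrightarrow> E x y \<Longrightarrow> E' (f x) (f y)"
  shows "disj_paths W E' n (f u) (f v) (map f ` P)"
proof -
  have PV: "set p \<subseteq> V" if "p \<in> P" for p
    using P that by (auto simp: disj_paths_def gpath_def)
  have "inj_on (map f) P"
    by (rule inj_on_mapI, rule inj_on_subset[OF f(1)]) (use PV in auto)
  then have "card (map f ` P) = n" using P by (simp add: card_image disj_paths_def)
  moreover have "gpath W E' (map f p) (f u) (f v)" if "p \<in> P" for p
    by (rule gpath_map[where E = E, OF _ f]) (use P that E in \<open>auto simp: disj_paths_def\<close>)
  moreover have "set (map f p) \<inter> set (map f q) \<subseteq> {f u, f v}"
    if "p \<in> P" "q \<in> P" "map f p \<noteq> map f q" for p q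
  proof -
    have "set p \<inter> set q \<subseteq> {u, v}" using P that unfolding disj_paths_def by metis
    moreover have "f ` set p \<inter> f ` set q = f ` (set p \<inter> set q)"
      using inj_on_image_Int[OF f(1) PV[OF that(1)] PV[OF that(2)]] by simp
    ultimately show ?thesis by auto
  qed
  ultimately show ?thesis using P unfolding disj_paths_def by simp
qed

lemma wide_dist_image_le:
  assumes "inj_on f V" "f ` V \<subseteq> W" "\<And>x y. x \<in> V \<Longrightarrow> y \<in> V \<Longrightarrow> E x y \<Longrightarrow> E' (f x) (f y)"
  shows "wide_dist W E' n (f u) (f v) \<le> wide_dist V E n u v"
proof (rule wide_dist_le_wide_distI)
  fix P assume "disj_paths V E n u v P"
  then have "disj_paths W E' n (f u) (f v) (map f ` P)"
    using assms by (rule disj_paths_map[where E = E])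
  then show "\<exists>Q. disj_paths W E' n (f u) (f v) Q \<and> plen ` Q \<subseteq> plen ` P"
    by (metis (no_types, lifting) image_cong image_image order_refl plen_map)
qed

lemma wide_dist_le_involution:
  assumes f: "\<And>x. f (f x) = x" and W: "f ` W \<subseteq> V"
    and E: "\<And>x y. x \<in> W \<Longrightarrow> y \<in> W \<Longrightarrow> E' x y \<Longrightarrow> E (f x) (f y)"
  shows "wide_dist V E n u v \<le> wide_dist W E' n (f u) (f v)"
proof -
  have "inj_on f W" by (rule inj_on_inverseI) (rule f)
  from wide_dist_image_le[where E = E' and E' = E, OF this W E] show ?thesis by (metis f)
qed

lemma disj_paths_rev:
  assumes "disj_paths V E n u v P" "\<And>x y. E x y \<Longrightarrow> E y x"
  shows "disj_paths V E n v u (rev ` P)"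
  using assms gpath_rev[of V E _ u v] by (auto simp: disj_paths_def card_image insert_commute)

lemma wide_dist_commute:
  assumes "\<And>x y. E x y \<Longrightarrow> E y x"
  shows "wide_dist V E n u v = wide_dist V E n v u"
proof -
  have "wide_dist V E n x y \<le> wide_dist V E n y x" for x y
  proof (rule wide_dist_le_wide_distI)
    fix P assume "disj_paths V E n y x P"
    then have "disj_paths V E n x y (rev ` P)" using assms by (rule disj_paths_rev)
    then show "\<exists>Q. disj_paths V E n x y Q \<and> plen ` Q \<subseteq> plen ` P"
      by (metis (no_types, lifting) image_cong image_image order_refl plen_rev)
  qed
  then show ?thesis by (simp add: antisym)
qed

lemma disj_paths_avoid_faults:
  assumes P: "disj_paths V E n u v P" and F: "finite F" "card F < n" "F \<inter> {u, v} = {}"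
  obtains p where "p \<in> P" "set p \<inter> F = {}"
proof -
  have "\<exists>p\<in>P. set p \<inter> F = {}"
  proof (rule ccontr)
    assume "\<not> ?thesis"
    then have "\<forall>p\<in>P. \<exists>x. x \<in> set p \<inter> F" by blast
    then obtain g where g: "\<And>p. p \<in> P \<Longrightarrow> g p \<in> set p \<inter> F" by metis
    have "inj_on g P"
    proof (rule inj_onI, rule ccontr)
      fix p q assume pq: "p \<in> P" "q \<in> P" "g p = g q" "p \<noteq> q"
      then have "set p \<inter> set q \<subseteq> {u, v}" using P unfolding disj_paths_def by blast
      then show False using g[OF pq(1)] g[OF pq(2)] pq(3) F(3) by auto
    qed
    then have "card P \<le> card F" using g F(1) by (intro card_inj_on_le[of g]) auto
    then show False using P F(2) by (simp add: disj_paths_def)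
  qed
  then show ?thesis using that by blast
qed

lemma gdist_le_wide_dist:
  assumes F: "F \<subseteq> V - {u, v}" "finite F"
  shows "gdist (V - F) E u v \<le> wide_dist V E (Suc (card F)) u v"
  unfolding wide_dist_def
proof (rule Inf_greatest, clarify)
  fix P assume P: "disj_paths V E (Suc (card F)) u v P"
  then obtain p where p: "p \<in> P" "set p \<inter> F = {}"
    using F by (elim disj_paths_avoid_faults[where F = F]) auto
  then have "gpath (V - F) E p u v" using P by (auto simp: disj_paths_def gpath_def)
  then have "gdist (V - F) E u v \<le> enat (plen p)" by (rule gdist_le_plen)
  also have "\<dots> \<le> Sup ((\<lambda>p. enat (plen p)) ` P)" using p(1) by (auto intro: Sup_upper)
  finally show "gdist (V - F) E u v \<le> Sup ((\<lambda>p. enat (plen p)) ` P)" .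
qed

lemma fault_diam_le_wide_diam: "fault_diam V E n \<le> wide_diam V E (Suc n)"
  unfolding fault_diam_def wide_diam_eq_Sup_wide_dist
  by (rule Sup_least, clarify, rule Sup_upper2[OF _ gdist_le_wide_dist]) blast+

section \<open>Disjoint routes\<close>

text \<open>Paths are only confined to disjoint sets; the first step \<open>E u a\<close> into the set keeps a
  route from degenerating to the edge between \<open>u\<close> and \<open>v\<close>.\<close>
definition route :: "'a set \<Rightarrow> ('a \<Rightarrow> 'a \<Rightarrow> bool) \<Rightarrow> nat \<Rightarrow> 'a \<Rightarrow> 'a \<Rightarrow> 'a set \<Rightarrow> bool" where
  "route V E k u v S \<longleftrightarrow> S \<subseteq> V - {u, v} \<and>
     (\<exists>a\<in>S. E u a \<and> gdist (insert v S) E a v < enat k)"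

lemma routeE_gpath:
  assumes "route V E k u v S" "u \<in> V" "v \<in> V" "u \<noteq> v"
  obtains p where "gpath V E p u v" "plen p \<le> k" "set p \<subseteq> {u, v} \<union> S" "set p \<inter> S \<noteq> {}"
proof -
  obtain a where a: "a \<in> S" "E u a" "gdist (insert v S) E a v < enat k" and S: "S \<subseteq> V - {u, v}"
    using assms(1) by (auto simp: route_def)
  obtain p where p: "gpath (insert v S) E p a v" "plen p < k" using gdist_lessE[OF a(3)] .
  then have p': "p \<noteq> []" "hd p = a" "a \<in> set p" "set p \<subseteq> insert v S" "u \<notin> set p"
    using S assms(4) by (auto simp: gpath_def)
  have "gpath V E p a v" using p(1) S assms(3) by (auto intro: gpath_mono)
  then have "gpath V E (u # p) u v" using p' a(2) assms(2) by (simp add: gpath_Cons)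
  then show ?thesis using p' p(2) a(1) by (intro that[of "u # p"]) (auto simp: plen_Cons)
qed

definition disjoint_routes ::
    "'a set \<Rightarrow> ('a \<Rightarrow> 'a \<Rightarrow> bool) \<Rightarrow> nat \<Rightarrow> 'a \<Rightarrow> 'a \<Rightarrow> nat \<Rightarrow> 'a set \<Rightarrow> bool" where
  "disjoint_routes V E k u v n U \<longleftrightarrow> (\<exists>\<S>. finite \<S> \<and> card \<S> = n \<and> pairwise disjnt \<S> \<and>
     (\<forall>S\<in>\<S>. route V E k u v S \<and> S \<subseteq> U))"

lemma disjoint_routes_UNION:
  assumes "finite I" "\<And>i. i \<in> I \<Longrightarrow> route V E k u v (S i)"
    and "\<And>i j. i \<in> I \<Longrightarrow> j \<in> I \<Longrightarrow> i \<noteq> j \<Longrightarrow> S i \<inter> S j = {}"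
  shows "disjoint_routes V E k u v (card I) (\<Union>i\<in>I. S i)"
proof -
  have "S i \<noteq> {}" if "i \<in> I" for i using assms(2)[OF that] by (auto simp: route_def)
  then have "inj_on S I" using assms(3) by (metis inf.idem inj_onI)
  then show ?thesis unfolding disjoint_routes_def
    using assms by (intro exI[of _ "S ` I"]) (auto simp: card_image pairwise_def disjnt_def)
qed

lemma disjoint_routes_insert:
  assumes "disjoint_routes V E k u v n U" "route V E k u v S" "S \<inter> U = {}"
  shows "disjoint_routes V E k u v (Suc n) (U \<union> S)"
proof -
  obtain \<S> where \<S>: "finite \<S>" "card \<S> = n" "pairwise disjnt \<S>"
      "\<forall>S\<in>\<S>. route V E k u v S \<and> S \<subseteq> U"
    using assms(1) unfolding disjoint_routes_def by auto
  have "S \<noteq> {}" using assms(2) by (auto simp: route_def)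
  then have "S \<notin> \<S>" using assms(3) \<S>(4) by blast
  moreover have "pairwise disjnt (insert S \<S>)"
    using \<S>(3,4) assms(3) unfolding pairwise_def disjnt_def by blast
  ultimately show ?thesis unfolding disjoint_routes_def
    using \<S> assms(2) by (intro exI[of _ "insert S \<S>"]) auto
qed

lemma disjoint_routesE_disj_paths:
  assumes routes: "disjoint_routes V E k u v n U" and uv: "u \<in> V" "v \<in> V" "u \<noteq> v"
  obtains P where "disj_paths V E n u v P" "\<And>p. p \<in> P \<Longrightarrow> plen p \<le> k"
    "\<And>p. p \<in> P \<Longrightarrow> \<not> set p \<subseteq> {u, v}"
proof -
  obtain \<S> where \<S>: "finite \<S>" "card \<S> = n" "pairwise disjnt \<S>"
      "\<And>S. S \<in> \<S> \<Longrightarrow> route V E k u v S"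
    using routes unfolding disjoint_routes_def by auto
  have "\<forall>S\<in>\<S>. \<exists>p. gpath V E p u v \<and> plen p \<le> k \<and> set p \<subseteq> {u, v} \<union> S \<and> set p \<inter> S \<noteq> {}"
    using routeE_gpath[OF \<S>(4) uv] by metis
  then obtain f where f: "\<And>S. S \<in> \<S> \<Longrightarrow> gpath V E (f S) u v"
      "\<And>S. S \<in> \<S> \<Longrightarrow> plen (f S) \<le> k"
      "\<And>S. S \<in> \<S> \<Longrightarrow> set (f S) \<subseteq> {u, v} \<union> S"
      "\<And>S. S \<in> \<S> \<Longrightarrow> set (f S) \<inter> S \<noteq> {}"
    by metis
  have inner: "\<not> set (f S) \<subseteq> {u, v}" if "S \<in> \<S>" for S
    using f(4)[OF that] \<S>(4)[OF that] by (auto simp: route_def)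
  have meet: "set (f S) \<inter> set (f T) \<subseteq> {u, v}" if "S \<in> \<S>" "T \<in> \<S>" "S \<noteq> T" for S T
    using f(3)[OF that(1)] f(3)[OF that(2)] \<S>(3) that unfolding pairwise_def disjnt_def by blast
  have "inj_on f \<S>" by (rule inj_onI) (metis meet inner inf.idem)
  then have "disj_paths V E n u v (f ` \<S>)"
    using \<S>(1,2) f(1) meet by (fastforce simp: disj_paths_def card_image)
  then show ?thesis using that f(2) inner by blast
qed

lemma wide_dist_le_if_disjoint_routes:
  assumes "disjoint_routes V E k u v n U" "u \<in> V" "v \<in> V" "u \<noteq> v"
  shows "wide_dist V E n u v \<le> enat k"
  using disjoint_routesE_disj_paths[OF assms] wide_dist_leI by metis

lemma wide_dist_le_if_disjoint_routes_edge:
  assumes routes: "disjoint_routes V E k u v n U" and uv: "u \<in> V" "v \<in> V" "u \<noteq> v"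
    and "E u v" "1 \<le> k"
  shows "wide_dist V E (Suc n) u v \<le> enat k"
proof -
  obtain P where P: "disj_paths V E n u v P" "\<And>p. p \<in> P \<Longrightarrow> plen p \<le> k"
      "\<And>p. p \<in> P \<Longrightarrow> \<not> set p \<subseteq> {u, v}"
    using disjoint_routesE_disj_paths[OF routes uv] by metis
  have "[u, v] \<notin> P" using P(3)[of "[u, v]"] by auto
  moreover have "gpath V E [u, v] u v" using uv \<open>E u v\<close> by (simp add: gpath_Cons)
  ultimately have "disj_paths V E (Suc n) u v (insert [u, v] P)"
    using P(1) by (auto simp: disj_paths_def)
  then show ?thesis by (rule wide_dist_leI) (use P(2) \<open>1 \<le> k\<close> in \<open>auto simp: plen_def\<close>)
qed

section \<open>Matchings\<close>

definition matching :: "('a \<times> 'b) set \<Rightarrow> bool" where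
  "matching M \<longleftrightarrow> finite M \<and> inj_on fst M \<and> inj_on snd M"

lemma obtain_matching:
  assumes "n \<le> card A" "n \<le> card B"
  obtains M where "M \<subseteq> A \<times> B" "matching M" "card M = n"
proof -
  obtain A' where A': "A' \<subseteq> A" "card A' = n" "finite A'"
    using obtain_subset_with_card_n[OF assms(1)] .
  obtain B' where B': "B' \<subseteq> B" "card B' = n" "finite B'"
    using obtain_subset_with_card_n[OF assms(2)] .
  obtain \<phi> where "bij_betw \<phi> A' B'" using finite_same_card_bij A' B' by metis
  then have "matching ((\<lambda>a. (a, \<phi> a)) ` A')" "(\<lambda>a. (a, \<phi> a)) ` A' \<subseteq> A \<times> B"
    using A' B' by (auto simp: matching_def bij_betw_def inj_on_def)
  moreover have "card ((\<lambda>a. (a, \<phi> a)) ` A') = n" using A'(2) by (simp add: card_image inj_on_def)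
  ultimately show ?thesis using that by blast
qed

lemma matching_eq_iff:
  "matching M \<Longrightarrow> (a, b) \<in> M \<Longrightarrow> (a', b') \<in> M \<Longrightarrow> a = a' \<longleftrightarrow> b = b'"
  unfolding matching_def inj_on_def by force

lemma obtain_matching_through:
  assumes "a \<in> A" "b \<in> B" "Suc n \<le> card A" "Suc n \<le> card B"
  obtains M where "M \<subseteq> A \<times> B" "matching M" "card M = Suc n" "(a, b) \<in> M"
proof -
  obtain M where M: "M \<subseteq> (A - {a}) \<times> (B - {b})" "matching M" "card M = n"
    by (rule obtain_matching[of n "A - {a}" "B - {b}"])
      (use assms in \<open>auto simp: card_Diff_singleton\<close>)
  have "matching (insert (a, b) M)" using M(1,2) by (auto simp: matching_def)
  moreover have "card (insert (a, b) M) = Suc n"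
    using M by (subst card_insert_disjoint) (auto simp: matching_def)
  moreover have "insert (a, b) M \<subseteq> A \<times> B" using M(1) assms by auto
  ultimately show ?thesis using that by blast
qed

lemma ex_elem_avoiding_two:
  assumes "3 \<le> card A"
  shows "\<exists>c\<in>A. c \<noteq> a \<and> c \<noteq> b"
proof (rule ccontr)
  assume "\<not> ?thesis"
  then have "card A \<le> card {a, b}" by (intro card_mono) auto
  also have "\<dots> \<le> 2" by (simp add: card_insert_if)
  finally show False using assms by simp
qed

lemma obtain_matching_avoiding:
  assumes "a \<in> A" "b' \<in> B" and n: "3 \<le> n" "n \<le> card A" "n \<le> card B"
  obtains M where "M \<subseteq> A \<times> B" "matching M" "card M = n" "(a, b) \<notin> M" "(a', b') \<notin> M"
proof -
  \<comment> \<open>A pair that shares exactly one coordinate with each forbidden pair excludes both.\<close>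
  have "\<exists>p\<in>A. \<exists>q\<in>B. (p = a) \<noteq> (q = b) \<and> (p = a') \<noteq> (q = b')"
  proof -
    obtain p q where "p \<in> A" "p \<noteq> a" "p \<noteq> a'" "q \<in> B" "q \<noteq> b" "q \<noteq> b'"
      using ex_elem_avoiding_two n le_trans by metis
    then show ?thesis using assms(1,2) by (cases "a = a'"; cases "b = b'") blast+
  qed
  then obtain p q where pq: "p \<in> A" "q \<in> B" "(p = a) \<noteq> (q = b)" "(p = a') \<noteq> (q = b')" by blast
  obtain M where M: "M \<subseteq> A \<times> B" "matching M" "card M = n" "(p, q) \<in> M"
    using obtain_matching_through[OF pq(1,2), of "n - 1"] n by auto
  then show ?thesis using that matching_eq_iff[OF M(2,4)] pq(3,4) by metis
qed

section \<open>Ternary words\<close>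

definition hamming :: "'a list \<Rightarrow> 'a list \<Rightarrow> nat" where
  "hamming X Y = card {i. i < length X \<and> X ! i \<noteq> Y ! i}"

lemma hamming_le_length: "hamming X Y \<le> length X"
  using card_mono[of "{..<length X}" "{i. i < length X \<and> X ! i \<noteq> Y ! i}"]
  by (auto simp: hamming_def)

lemma hamming_self [simp]: "hamming X X = 0"
  by (simp add: hamming_def)

lemma hamming_eq_length:
  "(\<And>i. i < length X \<Longrightarrow> X ! i \<noteq> Y ! i) \<Longrightarrow> hamming X Y = length X"
  by (simp add: hamming_def cong: conj_cong)

lemma hamming_triangle:
  assumes "length X = length Y"
  shows "hamming X Z \<le> hamming X Y + hamming Y Z"
proof -
  have "hamming X Z \<le> card ({i. i < length X \<and> X ! i \<noteq> Y ! i} \<union> {i. i < length Y \<and> Y ! i \<noteq> Z ! i})"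
    unfolding hamming_def using assms by (intro card_mono) auto
  also have "\<dots> \<le> hamming X Y + hamming Y Z" unfolding hamming_def by (rule card_Un_le)
  finally show ?thesis .
qed

lemma differ_one_iff_hamming: "differ_one X Y \<longleftrightarrow> length X = length Y \<and> hamming X Y = 1"
  by (simp add: differ_one_def hamming_def)

lemma hamming_le_Suc_if_differ_one: "differ_one X Y \<Longrightarrow> hamming X Z \<le> Suc (hamming Y Z)"
  using hamming_triangle[of X Y Z] by (simp add: differ_one_iff_hamming)

lemma differ_one_sym: "differ_one X Y \<Longrightarrow> differ_one Y X"
  unfolding differ_one_def by (auto simp: eq_commute[of "Y ! _"])

lemma differ_one_irrefl [simp]: "\<not> differ_one X X"
  by (simp add: differ_one_def)

lemma differ_one_list_update:
  assumes "i < length X" "c \<noteq> X ! i"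
  shows "differ_one X (X[i := c])"
proof -
  have "{j. j < length X \<and> X ! j \<noteq> X[i := c] ! j} = {i}"
    using assms by (auto simp: nth_list_update)
  then show ?thesis by (simp add: differ_one_def)
qed

lemma differ_oneE:
  assumes "differ_one X Y"
  obtains i c where "i < length X" "c \<noteq> X ! i" "Y = X[i := c]"
proof -
  have len: "length X = length Y" and "card {i. i < length X \<and> X ! i \<noteq> Y ! i} = 1"
    using assms by (auto simp: differ_one_def)
  then obtain i where i: "{i. i < length X \<and> X ! i \<noteq> Y ! i} = {i}"
    by (auto simp: card_1_singleton_iff)
  then have "X ! p = Y ! p" if "p < length X" "p \<noteq> i" for p using that by blast
  moreover have "i < length X" "Y ! i \<noteq> X ! i" using i by force+
  ultimately have "Y = X[i := Y ! i]"
    using len by (intro nth_equalityI) (auto simp: nth_list_update)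
  then show ?thesis using \<open>i < length X\<close> \<open>Y ! i \<noteq> X ! i\<close> by (rule that[rotated 2])
qed

lemma tern_words_iff: "X \<in> tern_words k \<longleftrightarrow> length X = k \<and> (\<forall>i<k. X ! i \<in> {0, 1, 2})"
  unfolding tern_words_def by (auto simp: in_set_conv_nth subset_iff)

lemma length_tern_words: "X \<in> tern_words k \<Longrightarrow> length X = k"
  by (simp add: tern_words_def)

lemma tern_words_nth: "X \<in> tern_words k \<Longrightarrow> i < k \<Longrightarrow> X ! i \<in> {0, 1, 2}"
  unfolding tern_words_iff by blast

lemma tern_words_list_update:
  "X \<in> tern_words k \<Longrightarrow> c \<in> {0, 1, 2} \<Longrightarrow> X[i := c] \<in> tern_words k"
  unfolding tern_words_def using set_update_subset_insert[of X i c] by auto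

lemma finite_tern_words: "finite (tern_words k)"
  unfolding tern_words_def
  using finite_lists_length_eq[of "{0, 1, 2 :: nat}" k] by (simp add: conj_commute)

lemma hamming_le_tern_words: "X \<in> tern_words k \<Longrightarrow> hamming X Y \<le> k"
  using hamming_le_length length_tern_words by blast

definition detour_word :: "nat \<Rightarrow> nat list \<Rightarrow> nat list \<Rightarrow> nat list \<Rightarrow> bool" where
  "detour_word k X Y W \<longleftrightarrow> W \<in> tern_words k \<and> W \<noteq> X \<and> W \<noteq> Y \<and> hamming X W + hamming W Y \<le> Suc k"

lemma ex_detour_word:
  assumes "X \<in> tern_words k" "Y \<in> tern_words k" "1 \<le> k"
  shows "\<exists>W. detour_word k X Y W"
proof -
  have "3 \<le> card {0, 1, 2 :: nat}" by simp
  then obtain c where c: "c \<in> {0, 1, 2}" "c \<noteq> X ! 0" "c \<noteq> Y ! 0"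
    using ex_elem_avoiding_two by metis
  have len: "length Y = k" using assms(2) by (rule length_tern_words)
  have "differ_one (Y[0 := c]) Y"
    using differ_one_sym differ_one_list_update[of 0 Y c] c len assms(3) by simp
  then have "hamming (Y[0 := c]) Y = 1" by (simp add: differ_one_iff_hamming)
  moreover have "Y[0 := c] ! 0 = c" using len assms(3) by simp
  moreover have "hamming X (Y[0 := c]) \<le> k" using assms(1) by (rule hamming_le_tern_words)
  ultimately have "detour_word k X Y (Y[0 := c])"
    using c tern_words_list_update[OF assms(2) c(1), of 0] by (auto simp: detour_word_def)
  then show ?thesis ..
qed

subsection \<open>Neighbourhoods\<close>

definition nbrs :: "nat \<Rightarrow> nat list \<Rightarrow> nat list set" where
  "nbrs k X = {P \<in> tern_words k. differ_one X P}"

definition closed_nbrs :: "nat \<Rightarrow> nat list \<Rightarrow> nat list set" where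
  "closed_nbrs k X = insert X (nbrs k X)"

lemma finite_nbrs [simp]: "finite (nbrs k X)"
  by (simp add: nbrs_def finite_tern_words)

lemma closed_nbrs_subset: "X \<in> tern_words k \<Longrightarrow> closed_nbrs k X \<subseteq> tern_words k"
  by (auto simp: closed_nbrs_def nbrs_def)

lemma differ_one_if_closed_nbr: "P \<in> closed_nbrs k X \<Longrightarrow> P \<noteq> X \<Longrightarrow> differ_one X P"
  by (auto simp: closed_nbrs_def nbrs_def)

lemma nbrsE:
  assumes "P \<in> nbrs k X" "X \<in> tern_words k"
  obtains i c where "i < k" "c \<in> {0, 1, 2}" "c \<noteq> X ! i" "P = X[i := c]"
proof -
  have P: "P \<in> tern_words k" "differ_one X P" using assms(1) by (auto simp: nbrs_def)
  obtain i c where ic: "i < length X" "c \<noteq> X ! i" "P = X[i := c]" using P(2) by (rule differ_oneE)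
  have "i < k" using ic(1) assms(2) by (simp add: length_tern_words)
  moreover have "c \<in> {0, 1, 2}" using tern_words_nth[OF P(1) \<open>i < k\<close>] ic by simp
  ultimately show ?thesis using ic that by blast
qed

lemma list_update_in_nbrs:
  "X \<in> tern_words k \<Longrightarrow> i < k \<Longrightarrow> c \<in> {0, 1, 2} \<Longrightarrow> c \<noteq> X ! i \<Longrightarrow> X[i := c] \<in> nbrs k X"
  by (simp add: nbrs_def tern_words_list_update differ_one_list_update length_tern_words)

lemma card_nbrs:
  assumes X: "X \<in> tern_words k"
  shows "card (nbrs k X) = 2 * k"
proof -
  let ?I = "SIGMA i:{..<k}. {0, 1, 2} - {X ! i}" and ?f = "\<lambda>(i, c). X[i := c]"
  have len: "length X = k" using X by (rule length_tern_words)
  have "inj_on ?f ?I"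
  proof (rule inj_onI)
    fix x y assume x: "x \<in> ?I" and y: "y \<in> ?I" and eq: "?f x = ?f y"
    obtain i c j e where xy: "x = (i, c)" "y = (j, e)" by (cases x, cases y)
    have "X[j := e] ! i = c"
      using x eq len unfolding xy by (auto dest: arg_cong[of _ _ "\<lambda>W. W ! i"])
    then show "x = y" using x y len unfolding xy by (auto simp: nth_list_update split: if_splits)
  qed
  moreover have "?f ` ?I = nbrs k X"
  proof
    show "?f ` ?I \<subseteq> nbrs k X" using list_update_in_nbrs[OF X] by auto
    show "nbrs k X \<subseteq> ?f ` ?I"
    proof
      fix P assume "P \<in> nbrs k X"
      then obtain i c where "i < k" "c \<in> {0, 1, 2}" "c \<noteq> X ! i" "P = X[i := c]"
        using X by (rule nbrsE)
      then show "P \<in> ?f ` ?I" by (intro image_eqI[of _ _ "(i, c)"]) auto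
    qed
  qed
  ultimately have "card (nbrs k X) = card ?I" by (metis card_image)
  also have "card ({0, 1, 2} - {X ! i}) = 2" if "i < k" for i
    using tern_words_nth[OF X that] by (auto simp: card_Diff_singleton)
  then have "card ?I = 2 * k" by simp
  finally show ?thesis .
qed

lemma card_closed_nbrs: "X \<in> tern_words k \<Longrightarrow> card (closed_nbrs k X) = Suc (2 * k)"
  using card_nbrs[of X k] by (simp add: closed_nbrs_def card_insert_if) (simp add: nbrs_def)

subsection \<open>Intervals of the Hamming graph\<close>

definition overwrite :: "'a list \<Rightarrow> 'a list \<Rightarrow> nat set \<Rightarrow> 'a list" where
  "overwrite X Y I = map (override_on ((!) X) ((!) Y) I) [0..<length X]"

lemma length_overwrite [simp]: "length (overwrite X Y I) = length X"
  by (simp add: overwrite_def)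

lemma nth_overwrite [simp]:
  "i < length X \<Longrightarrow> overwrite X Y I ! i = (if i \<in> I then Y ! i else X ! i)"
  by (simp add: overwrite_def)

lemma overwrite_empty [simp]: "overwrite X Y {} = X"
  by (simp add: list_eq_iff_nth_eq)

lemma overwrite_self [simp]: "overwrite X X I = X"
  by (simp add: list_eq_iff_nth_eq)

lemma overwrite_eq:
  "length X = length Y \<Longrightarrow> (\<And>i. i < length X \<Longrightarrow> X ! i \<noteq> Y ! i \<Longrightarrow> i \<in> I) \<Longrightarrow> overwrite X Y I = Y"
  by (auto simp: list_eq_iff_nth_eq)

lemma overwrite_insert: "overwrite X Y (insert i I) = (overwrite X Y I)[i := Y ! i]"
proof (rule nth_equalityI)
  fix j assume "j < length (overwrite X Y (insert i I))"
  then show "overwrite X Y (insert i I) ! j = (overwrite X Y I)[i := Y ! i] ! j"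
    by (cases "i = j") simp_all
qed simp

lemma overwrite_in_tern_words:
  "X \<in> tern_words k \<Longrightarrow> Y \<in> tern_words k \<Longrightarrow> overwrite X Y I \<in> tern_words k"
  by (simp add: tern_words_iff)

lemma overwrite_insert_eq_or_differ_one:
  assumes "i < length X"
  shows "overwrite X Y (insert i I) = overwrite X Y I \<or>
    differ_one (overwrite X Y I) (overwrite X Y (insert i I))"
proof (cases "overwrite X Y I ! i = Y ! i")
  case True
  then show ?thesis unfolding overwrite_insert by (metis list_update_id)
next
  case False
  then show ?thesis
    unfolding overwrite_insert using assms by (metis differ_one_list_update length_overwrite)
qed

definition prefix_overwrites :: "'a list \<Rightarrow> 'a list \<Rightarrow> nat list \<Rightarrow> 'a list set" where
  "prefix_overwrites X Y is = range (\<lambda>l. overwrite X Y (set (take l is)))"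

lemma left_in_prefix_overwrites: "X \<in> prefix_overwrites X Y is"
  unfolding prefix_overwrites_def by (rule range_eqI[of _ _ 0]) simp

lemma right_in_prefix_overwrites: "overwrite X Y (set is) \<in> prefix_overwrites X Y is"
  unfolding prefix_overwrites_def by (rule range_eqI[of _ _ "length is"]) simp

lemma prefix_overwrites_subset_append: "prefix_overwrites X Y is \<subseteq> prefix_overwrites X Y (is @ js)"
proof -
  have "overwrite X Y (set (take l is)) = overwrite X Y (set (take (min l (length is)) (is @ js)))"
    for l by (simp add: min_def)
  then show ?thesis unfolding prefix_overwrites_def by blast
qed

lemma gdist_prefix_overwrites:
  assumes "set is \<subseteq> {..<length X}"
  shows "gdist (prefix_overwrites X Y is) differ_one X (overwrite X Y (set is)) \<le> enat (length is)"
  using assms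
proof (induction "is" rule: rev_induct)
  case Nil
  then show ?case by (simp add: gdist_self left_in_prefix_overwrites)
next
  case (snoc i js)
  let ?S = "prefix_overwrites X Y (js @ [i])"
  let ?W = "overwrite X Y (set js)" and ?W' = "overwrite X Y (set (js @ [i]))"
  have "gdist ?S differ_one X ?W \<le> gdist (prefix_overwrites X Y js) differ_one X ?W"
    by (rule gdist_antimono) (rule prefix_overwrites_subset_append)
  also have "\<dots> \<le> enat (length js)" using snoc by simp
  finally have to_W: "gdist ?S differ_one X ?W \<le> enat (length js)" .
  have mem: "?W \<in> ?S" "?W' \<in> ?S"
    using right_in_prefix_overwrites[of X Y js] right_in_prefix_overwrites[of X Y "js @ [i]"]
      prefix_overwrites_subset_append[of X Y js "[i]"] by auto
  have "?W' = ?W \<or> differ_one ?W ?W'"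
    using overwrite_insert_eq_or_differ_one[of i X Y "set js"] snoc.prems by simp
  then have "gdist ?S differ_one ?W ?W' \<le> enat 1"
    using gdist_self[OF mem(1)] gdist_edge_le[OF mem] by auto
  from gdist_triangle_le[OF to_W this] show ?case by simp
qed

definition hamming_interval :: "'a list \<Rightarrow> 'a list \<Rightarrow> 'a list set" where
  "hamming_interval X Y = range (overwrite X Y)"

lemma hamming_interval_self [simp]: "hamming_interval X X = {X}"
  by (auto simp: hamming_interval_def)

lemma left_in_hamming_interval: "X \<in> hamming_interval X Y"
  unfolding hamming_interval_def by (metis overwrite_empty rangeI)

lemma right_in_hamming_interval: "length X = length Y \<Longrightarrow> Y \<in> hamming_interval X Y"
  unfolding hamming_interval_def by (metis overwrite_eq UNIV_I rangeI)

lemma hamming_interval_subset_tern_words: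
  "X \<in> tern_words k \<Longrightarrow> Y \<in> tern_words k \<Longrightarrow> hamming_interval X Y \<subseteq> tern_words k"
  by (auto simp: hamming_interval_def overwrite_in_tern_words)

lemma gdist_hamming_interval:
  assumes "length X = length Y"
  shows "gdist (hamming_interval X Y) differ_one X Y \<le> enat (hamming X Y)"
proof -
  let ?D = "{i. i < length X \<and> X ! i \<noteq> Y ! i}"
  define "is" where "is = sorted_list_of_set ?D"
  have is_D: "set is = ?D" "length is = hamming X Y" by (auto simp: is_def hamming_def)
  have "gdist (hamming_interval X Y) differ_one X Y
      \<le> gdist (prefix_overwrites X Y is) differ_one X Y"
    by (rule gdist_antimono) (auto simp: prefix_overwrites_def hamming_interval_def)
  also have "overwrite X Y (set is) = Y" using assms by (intro overwrite_eq) (auto simp: is_D)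
  then have "gdist (prefix_overwrites X Y is) differ_one X Y \<le> enat (hamming X Y)"
    using gdist_prefix_overwrites[of "is" X Y] is_D by auto
  finally show ?thesis .
qed

lemma gdist_image_hamming_interval:
  assumes "inj f" "\<And>W W'. differ_one W W' \<Longrightarrow> E (f W) (f W')" "length X = length Y"
    and "f ` hamming_interval X Y = S"
  shows "gdist S E (f X) (f Y) \<le> enat (hamming X Y)"
proof -
  have "gdist S E (f X) (f Y) \<le> gdist (hamming_interval X Y) differ_one X Y"
    using assms by (intro gdist_image_le) (auto intro: inj_on_subset)
  also have "\<dots> \<le> enat (hamming X Y)" using assms(3) by (rule gdist_hamming_interval)
  finally show ?thesis .
qed

lemma obtain_first_closed_nbr:
  assumes Y: "Y \<in> tern_words k" and Y': "Y' \<in> tern_words k"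
  obtains Q where "Q \<in> closed_nbrs k Y'" "Y = Y' \<longleftrightarrow> Q = Y'"
    "hamming_interval Y Q \<inter> closed_nbrs k Y' \<subseteq> {Q}"
proof (cases "Y = Y'")
  case True
  then show ?thesis using that[of Y'] by (auto simp: closed_nbrs_def)
next
  case False
  have len: "length Y = k" "length Y' = k" using Y Y' length_tern_words by auto
  then obtain i where i: "i < k" "Y ! i \<noteq> Y' ! i" using False by (auto simp: list_eq_iff_nth_eq)
  define Q where "Q = Y'[i := Y ! i]"
  have Q: "Q \<in> nbrs k Y'"
    unfolding Q_def using Y' i tern_words_nth[OF Y] by (blast intro: list_update_in_nbrs)
  have "W = Q" if W: "W \<in> hamming_interval Y Q" "W \<in> closed_nbrs k Y'" for W
  proof -
    have Wi: "W ! i = Y ! i" using W(1) i len by (auto simp: hamming_interval_def Q_def)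
    then have "W \<in> nbrs k Y'" using W(2) i by (auto simp: closed_nbrs_def)
    then obtain j c where "W = Y'[j := c]" using Y' by (rule nbrsE)
    then show ?thesis using Wi i len unfolding Q_def by (cases "i = j") auto
  qed
  moreover have "Q \<noteq> Y'" using Q by (auto simp: nbrs_def)
  ultimately show ?thesis using False Q by (intro that[of Q]) (auto simp: closed_nbrs_def)
qed

subsection \<open>Fans\<close>

text \<open>The path from a neighbour \<open>P = X[i := c]\<close> of \<open>X\<close> to \<open>Y\<close> turns the letters of \<open>P\<close> into those of
  \<open>Y\<close> at the positions \<open>i + 1, \<dots>, k - 1, 0, \<dots>, i\<close> in this order. A word common to the paths from
  positions \<open>i \<noteq> j\<close> differs from \<open>X\<close> at both, so that one path has turned all positions from \<open>i + 1\<close>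
  to \<open>j\<close> and the other one all from \<open>j + 1\<close> to \<open>i\<close>: the word is \<open>Y\<close>.\<close>
definition cyclic_order :: "nat \<Rightarrow> nat \<Rightarrow> nat list" where
  "cyclic_order k i = [Suc i..<k] @ [0..<Suc i]"

definition fan :: "'a list \<Rightarrow> 'a list \<Rightarrow> 'a list \<Rightarrow> 'a list set" where
  "fan X Y P = (\<Union>i\<in>{i. i < length X \<and> P ! i \<noteq> X ! i}.
     prefix_overwrites P Y (cyclic_order (length X) i)) - {Y}"

lemma set_cyclic_order: "i < k \<Longrightarrow> set (cyclic_order k i) = {..<k}"
  by (auto simp: cyclic_order_def)

lemma length_cyclic_order: "i < k \<Longrightarrow> length (cyclic_order k i) = k"
  by (simp add: cyclic_order_def)

lemma set_take_upt: "set (take l [i..<j]) = {i..<min j (i + l)}"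
  by (cases "i + l \<le> j") auto

lemma set_take_cyclic_order:
  "set (take l (cyclic_order k i)) =
     {Suc i..<min k (Suc i + l)} \<union> {0..<min (Suc i) (l - (k - Suc i))}"
  unfolding cyclic_order_def by (simp only: take_append set_append set_take_upt length_upt add_0)

lemma fan_list_update:
  assumes "i < length X" "c \<noteq> X ! i"
  shows "fan X Y (X[i := c]) = prefix_overwrites (X[i := c]) Y (cyclic_order (length X) i) - {Y}"
proof -
  have "{j. j < length X \<and> X[i := c] ! j \<noteq> X ! j} = {i}" using assms by (auto simp: nth_list_update)
  then show ?thesis by (simp add: fan_def)
qed

lemma target_notin_fan: "Y \<notin> fan X Y P"
  by (simp add: fan_def)

lemma nth_in_fan:
  assumes i: "i < length X" "c \<noteq> X ! i" and len: "length X = length Y"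
    and W: "W \<in> fan X Y (X[i := c])"
  shows "W ! i = c"
proof -
  obtain l where l: "W = overwrite (X[i := c]) Y (set (take l (cyclic_order (length X) i)))" "W \<noteq> Y"
    using W unfolding fan_list_update[OF i] prefix_overwrites_def by blast
  have "l < length X"
  proof (rule ccontr)
    assume "\<not> l < length X"
    then have "set (take l (cyclic_order (length X) i)) = {..<length X}"
      using i(1) by (simp add: set_cyclic_order length_cyclic_order)
    then have "W = Y" unfolding l(1) using len by (intro overwrite_eq) auto
    then show False using l(2) by contradiction
  qed
  then have "i \<notin> set (take l (cyclic_order (length X) i))"
    using i(1) by (auto simp: set_take_cyclic_order)
  then show ?thesis using l(1) i(1) by simp
qed

lemma fan_subset_tern_words:
  assumes "Y \<in> tern_words k" "P \<in> tern_words k"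
  shows "fan X Y P \<subseteq> tern_words k"
  using overwrite_in_tern_words[OF assms(2,1)] by (auto simp: fan_def prefix_overwrites_def)

lemma center_notin_fan:
  assumes X: "X \<in> tern_words k" and Y: "Y \<in> tern_words k" and P: "P \<in> nbrs k X"
  shows "X \<notin> fan X Y P"
proof -
  obtain i c where "i < k" "c \<noteq> X ! i" "P = X[i := c]" using P X by (rule nbrsE)
  then show ?thesis
    using nth_in_fan[of i X c Y X] length_tern_words[OF X] length_tern_words[OF Y] by auto
qed

lemma nbr_in_fan:
  assumes X: "X \<in> tern_words k" and P: "P \<in> nbrs k X" and "P \<noteq> Y"
  shows "P \<in> fan X Y P"
proof -
  obtain i c where "i < k" "c \<noteq> X ! i" "P = X[i := c]" using P X by (rule nbrsE)
  then show ?thesis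
    using \<open>P \<noteq> Y\<close> length_tern_words[OF X] by (simp add: fan_list_update left_in_prefix_overwrites)
qed

lemma gdist_fan:
  assumes X: "X \<in> tern_words k" and Y: "Y \<in> tern_words k" and P: "P \<in> nbrs k X"
  shows "gdist (insert Y (fan X Y P)) differ_one P Y \<le> enat k"
proof -
  obtain i c where ic: "i < k" "c \<noteq> X ! i" "P = X[i := c]" using P X by (rule nbrsE)
  have len: "length X = k" "length Y = k" "length P = k" using X Y ic(3) length_tern_words by auto
  let ?is = "cyclic_order k i"
  have "prefix_overwrites P Y ?is \<subseteq> insert Y (fan X Y P)"
    using ic len fan_list_update[of i X c Y] by auto
  then have "gdist (insert Y (fan X Y P)) differ_one P Y
      \<le> gdist (prefix_overwrites P Y ?is) differ_one P Y"
    by (rule gdist_antimono)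
  also have "overwrite P Y (set ?is) = Y"
    using len ic(1) by (intro overwrite_eq) (auto simp: set_cyclic_order)
  then have "gdist (prefix_overwrites P Y ?is) differ_one P Y \<le> enat (length ?is)"
    using gdist_prefix_overwrites[of ?is P Y] ic(1) len by (auto simp: set_cyclic_order)
  finally show ?thesis using ic(1) by (simp add: length_cyclic_order)
qed

lemma fan_disjoint:
  assumes X: "X \<in> tern_words k" and Y: "Y \<in> tern_words k"
    and P: "P \<in> nbrs k X" and Q: "Q \<in> nbrs k X" and "P \<noteq> Q"
  shows "fan X Y P \<inter> fan X Y Q = {}"
proof (rule ccontr)
  assume "\<not> ?thesis"
  then obtain W where W: "W \<in> fan X Y P" "W \<in> fan X Y Q" by blast
  have len: "length X = k" "length Y = k" using X Y length_tern_words by auto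
  obtain i c where ic: "i < k" "c \<noteq> X ! i" "P = X[i := c]" using P X by (rule nbrsE)
  obtain j e where je: "j < k" "e \<noteq> X ! j" "Q = X[j := e]" using Q X by (rule nbrsE)
  have Wi: "W ! i = c" and Wj: "W ! j = e"
    using nth_in_fan[of i X c Y W] nth_in_fan[of j X e Y W] W ic je len by simp_all
  then have "i \<noteq> j" using ic(3) je(3) \<open>P \<noteq> Q\<close> by blast
  obtain l where l: "W = overwrite P Y (set (take l (cyclic_order k i)))"
    using W(1) ic fan_list_update[of i X c Y] len by (auto simp: prefix_overwrites_def)
  obtain m where m: "W = overwrite Q Y (set (take m (cyclic_order k j)))"
    using W(2) je fan_list_update[of j X e Y] len by (auto simp: prefix_overwrites_def)
  have "j \<in> set (take l (cyclic_order k i))"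
    using Wj l ic je(1,2) len \<open>i \<noteq> j\<close> by (auto split: if_splits)
  moreover have "i \<in> set (take m (cyclic_order k j))"
    using Wi m je ic(1,2) len \<open>i \<noteq> j\<close> by (auto split: if_splits)
  ultimately have "p \<in> set (take l (cyclic_order k i)) \<union> set (take m (cyclic_order k j))"
    if "p < k" for p
    using that ic(1) je(1) \<open>i \<noteq> j\<close> by (auto simp: set_take_cyclic_order)
  moreover have "W ! p = Y ! p" if "p < k" "p \<in> set (take l (cyclic_order k i))" for p
    using that unfolding l by (simp add: ic(3) len)
  moreover have "W ! p = Y ! p" if "p < k" "p \<in> set (take m (cyclic_order k j))" for p
    using that unfolding m by (simp add: je(3) len)
  ultimately have "W ! p = Y ! p" if "p < k" for p using that by blast
  then have "W = Y" using l ic(3) len by (intro nth_equalityI) auto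
  then show False using W(1) target_notin_fan by blast
qed

section \<open>Tours in the exchanged 3-ary cube\<close>

lemma E3C_E_sym: "E3C_E x y \<Longrightarrow> E3C_E y x"
  unfolding E3C_E_def by (auto dest: differ_one_sym split: prod.splits)

lemma E3C_E_layer: "d \<noteq> d' \<Longrightarrow> E3C_E (A, B, C, d) (A, B, C, d')"
  by (auto simp: E3C_E_def)

lemma E3C_E_A: "differ_one A A' \<Longrightarrow> E3C_E (A, B, C, 2) (A', B, C, 2)"
  by (auto simp: E3C_E_def)

lemma E3C_E_B: "differ_one B B' \<Longrightarrow> E3C_E (A, B, C, 1) (A, B', C, 1)"
  by (auto simp: E3C_E_def)

lemma E3C_E_C: "differ_one C C' \<Longrightarrow> E3C_E (A, B, C, 0) (A, B, C', 0)"
  by (auto simp: E3C_E_def)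

lemma E3C_V_iff [simp]: "(A, B, C, d) \<in> E3C_V r s t \<longleftrightarrow>
    A \<in> tern_words r \<and> B \<in> tern_words s \<and> C \<in> tern_words t \<and> d \<in> {0, 1, 2}"
  by (simp add: E3C_V_def)

text \<open>A tour lists only its waypoints. A hop between consecutive waypoints either changes the layer
  or moves, within a layer, through the Hamming interval of the word that may vary there; its region
  is a product in both cases.\<close>
fun hop :: "e3c_vertex \<Rightarrow> e3c_vertex \<Rightarrow> bool" where
  "hop (A, B, C, d) (A', B', C', d') \<longleftrightarrow>
     (A = A' \<or> d = 2 \<and> d' = 2) \<and> (B = B' \<or> d = 1 \<and> d' = 1) \<and> (C = C' \<or> d = 0 \<and> d' = 0)"

fun hop_region :: "e3c_vertex \<Rightarrow> e3c_vertex \<Rightarrow> e3c_vertex set" where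
  "hop_region (A, B, C, d) (A', B', C', d') =
     hamming_interval A A' \<times> hamming_interval B B' \<times> hamming_interval C C' \<times> {d, d'}"

fun hop_length :: "e3c_vertex \<Rightarrow> e3c_vertex \<Rightarrow> nat" where
  "hop_length (A, B, C, d) (A', B', C', d') =
     hamming A A' + hamming B B' + hamming C C' + (if d = d' then 0 else 1)"

lemma gdist_hop_region:
  assumes "hop x y" "x \<in> E3C_V r s t" "y \<in> E3C_V r s t"
  shows "gdist (hop_region x y) E3C_E x y \<le> enat (hop_length x y)"
proof -
  obtain A B C d where x: "x = (A, B, C, d)" by (cases x)
  obtain A' B' C' d' where y: "y = (A', B', C', d')" by (cases y)
  have len: "length A = length A'" "length B = length B'" "length C = length C'"
    using assms(2,3) by (auto simp: x y length_tern_words)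
  consider (layer) "A = A'" "B = B'" "C = C'" "d \<noteq> d'" | (stay) "x = y"
    | (A) "d = 2" "d' = 2" "B = B'" "C = C'"
    | (B) "d = 1" "d' = 1" "A = A'" "C = C'"
    | (C) "d = 0" "d' = 0" "A = A'" "B = B'"
    using assms(1) by (auto simp: x y)
  then show ?thesis
  proof cases
    case layer
    then show ?thesis
      using gdist_edge_le[of x "hop_region x y" y] by (simp add: x y E3C_E_layer)
  next
    case stay
    then show ?thesis unfolding stay y by (simp add: gdist_self)
  next
    case A
    have "gdist (hop_region x y) E3C_E (A, B, C, 2) (A', B, C, 2) \<le> enat (hamming A A')"
      by (rule gdist_image_hamming_interval[where f = "\<lambda>W. (W, B, C, 2)"])
        (use len E3C_E_A A in \<open>auto simp: x y inj_on_def\<close>)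
    then show ?thesis using A by (simp add: x y)
  next
    case B
    have "gdist (hop_region x y) E3C_E (A, B, C, 1) (A, B', C, 1) \<le> enat (hamming B B')"
      by (rule gdist_image_hamming_interval[where f = "\<lambda>W. (A, W, C, 1)"])
        (use len E3C_E_B B in \<open>auto simp: x y inj_on_def\<close>)
    then show ?thesis using B by (simp add: x y)
  next
    case C
    have "gdist (hop_region x y) E3C_E (A, B, C, 0) (A, B, C', 0) \<le> enat (hamming C C')"
      by (rule gdist_image_hamming_interval[where f = "\<lambda>W. (A, B, W, 0)"])
        (use len E3C_E_C C in \<open>auto simp: x y inj_on_def\<close>)
    then show ?thesis using C by (simp add: x y)
  qed
qed

fun tour_region :: "e3c_vertex list \<Rightarrow> e3c_vertex set" where
  "tour_region [] = {}"
| "tour_region [x] = {x}"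
| "tour_region (x # y # xs) = hop_region x y \<union> tour_region (y # xs)"

fun tour_length :: "e3c_vertex list \<Rightarrow> nat" where
  "tour_length (x # y # xs) = hop_length x y + tour_length (y # xs)"
| "tour_length _ = 0"

lemma hd_in_tour_region: "xs \<noteq> [] \<Longrightarrow> hd xs \<in> tour_region xs"
  by (induction xs rule: tour_region.induct)
    (auto simp: left_in_hamming_interval elim!: hop_region.elims)

lemma hop_region_subset_E3C_V:
  assumes "x \<in> E3C_V r s t" "y \<in> E3C_V r s t"
  shows "hop_region x y \<subseteq> E3C_V r s t"
proof -
  obtain A B C d A' B' C' d' where xy: "x = (A, B, C, d)" "y = (A', B', C', d')"
    by (cases x, cases y)
  have "hamming_interval A A' \<subseteq> tern_words r" "hamming_interval B B' \<subseteq> tern_words s"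
      "hamming_interval C C' \<subseteq> tern_words t"
    using assms unfolding xy by (simp_all add: hamming_interval_subset_tern_words)
  then show ?thesis using assms unfolding xy by auto
qed

lemma tour_region_subset_E3C_V: "set xs \<subseteq> E3C_V r s t \<Longrightarrow> tour_region xs \<subseteq> E3C_V r s t"
  by (induction xs rule: tour_region.induct) (simp_all add: hop_region_subset_E3C_V)

lemma gdist_tour_region:
  assumes "xs \<noteq> []" "set xs \<subseteq> E3C_V r s t" "successively hop xs"
  shows "gdist (tour_region xs) E3C_E (hd xs) (last xs) \<le> enat (tour_length xs)"
  using assms
proof (induction xs rule: tour_region.induct)
  case (3 x y xs)
  let ?S = "tour_region (x # y # xs)"
  have "gdist ?S E3C_E x y \<le> gdist (hop_region x y) E3C_E x y" by (rule gdist_antimono) simp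
  also have "\<dots> \<le> enat (hop_length x y)" using 3 by (intro gdist_hop_region) auto
  finally have first: "gdist ?S E3C_E x y \<le> enat (hop_length x y)" .
  have "gdist ?S E3C_E y (last (y # xs)) \<le> gdist (tour_region (y # xs)) E3C_E y (last (y # xs))"
    by (rule gdist_antimono) simp
  also have "\<dots> \<le> enat (tour_length (y # xs))" using 3 by simp
  finally show ?case using gdist_triangle_le[OF first] by simp
qed (simp_all add: gdist_self)

lemma route_tour_extended:
  assumes tour: "xs \<noteq> []" "set xs \<subseteq> E3C_V r s t" "successively hop xs"
    and start: "E3C_E u (hd xs)" and S: "tour_region xs \<subseteq> S" "S \<subseteq> E3C_V r s t - {u, v}"
    and rest: "gdist (insert v S) E3C_E (last xs) v \<le> enat l" and k: "tour_length xs + l < k"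
  shows "route (E3C_V r s t) E3C_E k u v S"
proof -
  have "gdist (insert v S) E3C_E (hd xs) (last xs) \<le> gdist (tour_region xs) E3C_E (hd xs) (last xs)"
    using S(1) by (intro gdist_antimono) auto
  also have "\<dots> \<le> enat (tour_length xs)" using tour by (rule gdist_tour_region)
  finally have "gdist (insert v S) E3C_E (hd xs) v \<le> enat (tour_length xs + l)"
    using rest by (rule gdist_triangle_le)
  also have "\<dots> < enat k" using k by simp
  finally show ?thesis
    using S hd_in_tour_region[OF tour(1)] start unfolding route_def by blast
qed

lemma route_tour:
  assumes tour: "xs \<noteq> []" "set xs \<subseteq> E3C_V r s t" "successively hop xs"
    and ends: "E3C_E u (hd xs)" "E3C_E (last xs) v"
    and avoid: "u \<notin> tour_region xs" "v \<notin> tour_region xs" and k: "tour_length xs + 2 \<le> k"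
  shows "route (E3C_V r s t) E3C_E k u v (tour_region xs)"
proof (rule route_tour_extended[OF tour ends(1) order_refl])
  have "last xs \<in> tour_region xs" using tour(1)
    by (induction xs rule: tour_region.induct) auto
  then show "gdist (insert v (tour_region xs)) E3C_E (last xs) v \<le> enat 1"
    using ends(2) by (intro gdist_edge_le) auto
  show "tour_region xs \<subseteq> E3C_V r s t - {u, v}"
    using tour_region_subset_E3C_V[OF tour(2)] avoid by blast
qed (use k in simp)

section \<open>Routes from layer 2\<close>

locale E3C_pair =
  fixes r s t :: nat and A B C A' B' C' :: "nat list"
  assumes A: "A \<in> tern_words r" and B: "B \<in> tern_words s" and C: "C \<in> tern_words t"
    and A': "A' \<in> tern_words r" and B': "B' \<in> tern_words s" and C': "C' \<in> tern_words t"
    and pos: "1 \<le> s" "1 \<le> t"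
begin

abbreviation "V \<equiv> E3C_V r s t"
abbreviation "k \<equiv> r + s + t + 6"
abbreviation "u \<equiv> (A, B, C, 2::nat)"
abbreviation "v\<^sub>1 \<equiv> (A', B', C', 1::nat)"
abbreviation "v\<^sub>2 \<equiv> (A', B', C', 2::nat)"

lemmas words = A B C A' B' C'

text \<open>The word \<open>D\<close>, different from both end words, moves the middle part of a detour to slices
  that no other route visits.\<close>
definition C_detour :: "nat list \<Rightarrow> e3c_vertex list" where
  "C_detour D = [(A, B, C, 0), (A, B, D, 0), (A, B, D, 2), (A', B, D, 2), (A', B, D, 1),
     (A', B', D, 1), (A', B', D, 0), (A', B', C', 0)]"

definition B_detour :: "nat list \<Rightarrow> e3c_vertex list" where
  "B_detour D = [(A, B, C, 1), (A, D, C, 1), (A, D, C, 0), (A, D, C', 0), (A, D, C', 2),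
     (A', D, C', 2), (A', D, C', 1), (A', B', C', 1)]"

lemma route_C_detour:
  assumes D: "detour_word t C C' D" and d: "d \<in> {1, 2}"
  shows "route V E3C_E k u (A', B', C', d) (tour_region (C_detour D))"
proof (rule route_tour)
  show "tour_length (C_detour D) + 2 \<le> k"
    using D hamming_le_tern_words[OF A, of A'] hamming_le_tern_words[OF B, of B']
    by (simp add: C_detour_def detour_word_def)
qed (use D d words in \<open>auto simp: C_detour_def detour_word_def E3C_E_layer\<close>)

lemma route_B_detour:
  assumes D: "detour_word s B B' D"
  shows "route V E3C_E k u v\<^sub>2 (tour_region (B_detour D))"
proof (rule route_tour)
  show "tour_length (B_detour D) + 2 \<le> k"
    using D hamming_le_tern_words[OF A, of A'] hamming_le_tern_words[OF C, of C']
    by (simp add: B_detour_def detour_word_def)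
qed (use D words in \<open>auto simp: B_detour_def detour_word_def E3C_E_layer\<close>)

subsection \<open>Targets in layer 2\<close>

definition fan_tour :: "nat list \<Rightarrow> e3c_vertex list" where
  "fan_tour P = [(P, B, C, 2), (P, B, C, 1), (P, B', C, 1), (P, B', C, 0), (P, B', C', 0)]"

definition fan_region :: "nat list \<Rightarrow> e3c_vertex set" where
  "fan_region P = tour_region (fan_tour P) \<union> fan A A' P \<times> {B'} \<times> {C'} \<times> {2}"

lemma route_fan_region:
  assumes P: "P \<in> nbrs r A" and ne: "P \<noteq> A' \<or> B \<noteq> B' \<or> C \<noteq> C'"
  shows "route V E3C_E k u v\<^sub>2 (fan_region P)"
proof (rule route_tour_extended[where xs = "fan_tour P" and l = "Suc r"])
  have P': "P \<in> tern_words r" "differ_one A P" "P \<noteq> A" using P by (auto simp: nbrs_def)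
  show tour: "set (fan_tour P) \<subseteq> V" using words P' by (simp add: fan_tour_def)
  show "E3C_E u (hd (fan_tour P))" using P' by (simp add: fan_tour_def E3C_E_A)
  show "tour_region (fan_tour P) \<subseteq> fan_region P" by (simp add: fan_region_def)
  show "fan_region P \<subseteq> V - {u, v\<^sub>2}"
    using tour_region_subset_E3C_V[OF tour] fan_subset_tern_words[OF A' P'(1), of A] words P'(3) ne
      center_notin_fan[OF A A' P] target_notin_fan[of A' A P]
    by (auto simp: fan_region_def) (auto simp: fan_tour_def)
  show "tour_length (fan_tour P) + Suc r < k"
    using hamming_le_tern_words[OF B, of B'] hamming_le_tern_words[OF C, of C']
    by (simp add: fan_tour_def)
  let ?S = "insert v\<^sub>2 (fan_region P)"
  have "(P, B', C', 2) \<in> ?S" using nbr_in_fan[OF A P] by (auto simp: fan_region_def)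
  moreover have "(P, B', C', 0) \<in> ?S"
    by (simp add: fan_region_def fan_tour_def right_in_hamming_interval)
  ultimately have step: "gdist ?S E3C_E (last (fan_tour P)) (P, B', C', 2) \<le> enat 1"
    by (intro gdist_edge_le) (simp_all add: fan_tour_def E3C_E_layer)
  have "gdist ?S E3C_E (P, B', C', 2) v\<^sub>2 \<le> gdist (insert A' (fan A A' P)) differ_one P A'"
    by (rule gdist_image_le[where f = "\<lambda>W. (W, B', C', 2)"])
      (auto simp: inj_on_def fan_region_def E3C_E_A)
  also have "\<dots> \<le> enat r" using A A' P by (rule gdist_fan)
  finally show "gdist ?S E3C_E (last (fan_tour P)) v\<^sub>2 \<le> enat (Suc r)"
    using gdist_triangle_le[OF step] by simp
qed (simp_all add: fan_tour_def)

lemma fan_region_disjoint: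
  assumes "P \<in> nbrs r A" "Q \<in> nbrs r A" "P \<noteq> Q"
    and "P \<noteq> A' \<or> B \<noteq> B' \<or> C \<noteq> C'" "Q \<noteq> A' \<or> B \<noteq> B' \<or> C \<noteq> C'"
  shows "fan_region P \<inter> fan_region Q = {}"
  using fan_disjoint[OF A A' assms(1-3)] assms(3-5)
    nbr_in_fan[OF A assms(1)] nbr_in_fan[OF A assms(2)]
  unfolding fan_region_def fan_tour_def by auto

lemma disjoint_routes_fan_regions:
  assumes "N \<subseteq> nbrs r A" "A' \<notin> N \<or> B \<noteq> B' \<or> C \<noteq> C'"
  shows "disjoint_routes V E3C_E k u v\<^sub>2 (card N) (\<Union>P\<in>N. fan_region P)"
  using assms finite_subset[OF assms(1) finite_nbrs]
  by (intro disjoint_routes_UNION route_fan_region fan_region_disjoint) auto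

lemma disjoint_routes_fan_detours:
  defines "N \<equiv> nbrs r A - {A'}"
  obtains U where "disjoint_routes V E3C_E k u v\<^sub>2 (Suc (Suc (card N))) U"
proof -
  obtain D\<^sub>B where D\<^sub>B: "detour_word s B B' D\<^sub>B" using ex_detour_word[OF B B' pos(1)] ..
  obtain D\<^sub>C where D\<^sub>C: "detour_word t C C' D\<^sub>C" using ex_detour_word[OF C C' pos(2)] ..
  have N: "A \<notin> N" "A' \<notin> N" by (auto simp: N_def nbrs_def)
  have "disjoint_routes V E3C_E k u v\<^sub>2 (card N) (\<Union>P\<in>N. fan_region P)"
    by (rule disjoint_routes_fan_regions) (auto simp: N_def)
  then have "disjoint_routes V E3C_E k u v\<^sub>2 (Suc (card N))
      ((\<Union>P\<in>N. fan_region P) \<union> tour_region (B_detour D\<^sub>B))"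
    by (rule disjoint_routes_insert[OF _ route_B_detour[OF D\<^sub>B]])
      (use N D\<^sub>B in \<open>auto simp: B_detour_def fan_region_def fan_tour_def detour_word_def\<close>)
  then have "disjoint_routes V E3C_E k u v\<^sub>2 (Suc (Suc (card N)))
      ((\<Union>P\<in>N. fan_region P) \<union> tour_region (B_detour D\<^sub>B) \<union> tour_region (C_detour D\<^sub>C))"
    by (rule disjoint_routes_insert[OF _ route_C_detour[OF D\<^sub>C]])
      (use N D\<^sub>B D\<^sub>C in \<open>auto simp: B_detour_def C_detour_def fan_region_def fan_tour_def
        detour_word_def\<close>)
  then show ?thesis by (rule that)
qed

lemma wide_dist_v2_if_not_adjacent:
  assumes "u \<noteq> v\<^sub>2" "\<not> differ_one A A'"
  shows "wide_dist V E3C_E (2 * r + 2) u v\<^sub>2 \<le> enat k"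
proof -
  have N: "nbrs r A - {A'} = nbrs r A" using assms(2) by (auto simp: nbrs_def)
  obtain U where "disjoint_routes V E3C_E k u v\<^sub>2 (Suc (Suc (card (nbrs r A)))) U"
    using disjoint_routes_fan_detours unfolding N .
  from wide_dist_le_if_disjoint_routes[OF this] show ?thesis
    using words assms(1) card_nbrs[OF A] by simp
qed

lemma wide_dist_v2_if_edge:
  assumes "differ_one A A'" "B = B'" "C = C'"
  shows "wide_dist V E3C_E (2 * r + 2) u v\<^sub>2 \<le> enat k"
proof -
  obtain U where U: "disjoint_routes V E3C_E k u v\<^sub>2 (Suc (Suc (card (nbrs r A - {A'})))) U"
    using disjoint_routes_fan_detours .
  have "A' \<in> nbrs r A" "A \<noteq> A'" using assms(1) A' by (auto simp: nbrs_def)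
  then have "Suc (card (nbrs r A - {A'})) = 2 * r"
    using card_nbrs[OF A] card_Suc_Diff1[of "nbrs r A" A'] by simp
  moreover have "E3C_E u v\<^sub>2" using assms by (simp add: E3C_E_A)
  ultimately show ?thesis
    using wide_dist_le_if_disjoint_routes_edge[OF U] words \<open>A \<noteq> A'\<close> by simp
qed

text \<open>If \<open>A\<close> and \<open>A'\<close> are adjacent but \<open>u\<close> and \<open>v\<^sub>2\<close> are not, the fan does not use the last step from
  \<open>(A, B', C', 2)\<close> to \<open>v\<^sub>2\<close>, and \<open>fan_region A'\<close> arrives through \<open>(A', B', C', 0)\<close> as \<open>C_detour\<close>
  does.\<close>
definition adjacent_C_detour :: "nat list \<Rightarrow> e3c_vertex list" where
  "adjacent_C_detour D = [(A, B, C, 0), (A, B, D, 0), (A, B, D, 1), (A, B', D, 1), (A, B', D, 0),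
     (A, B', C', 0), (A, B', C', 2)]"

lemma route_adjacent_C_detour:
  assumes D: "detour_word t C C' D" and adj: "differ_one A A'" and "C \<noteq> C'"
  shows "route V E3C_E k u v\<^sub>2 (tour_region (adjacent_C_detour D))"
proof (rule route_tour)
  show "tour_length (adjacent_C_detour D) + 2 \<le> k"
    using D hamming_le_tern_words[OF B, of B'] by (simp add: adjacent_C_detour_def detour_word_def)
qed (use D words adj \<open>C \<noteq> C'\<close> in
  \<open>auto simp: adjacent_C_detour_def detour_word_def E3C_E_layer E3C_E_A\<close>)

lemma wide_dist_v2_if_adjacent_words:
  assumes adj: "differ_one A A'" and "C \<noteq> C'"
  shows "wide_dist V E3C_E (2 * r + 2) u v\<^sub>2 \<le> enat k"
proof -
  let ?F = "\<Union>P\<in>nbrs r A. fan_region P"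
  obtain D\<^sub>B where D\<^sub>B: "detour_word s B B' D\<^sub>B" using ex_detour_word[OF B B' pos(1)] ..
  obtain D\<^sub>C where D\<^sub>C: "detour_word t C C' D\<^sub>C" using ex_detour_word[OF C C' pos(2)] ..
  have nbr_ne_A: "P \<noteq> A" "A \<notin> fan A A' P" if "P \<in> nbrs r A" for P
    using center_notin_fan[OF A A' that] that by (auto simp: nbrs_def)
  have "disjoint_routes V E3C_E k u v\<^sub>2 (2 * r) ?F"
    using disjoint_routes_fan_regions[OF order_refl] \<open>C \<noteq> C'\<close> card_nbrs[OF A] by simp
  then have "disjoint_routes V E3C_E k u v\<^sub>2 (Suc (2 * r)) (?F \<union> tour_region (B_detour D\<^sub>B))"
    by (rule disjoint_routes_insert[OF _ route_B_detour[OF D\<^sub>B]])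
      (use \<open>C \<noteq> C'\<close> D\<^sub>B in
        \<open>auto simp: B_detour_def fan_region_def fan_tour_def detour_word_def dest: nbr_ne_A(1)\<close>)
  then have "disjoint_routes V E3C_E k u v\<^sub>2 (Suc (Suc (2 * r)))
      (?F \<union> tour_region (B_detour D\<^sub>B) \<union> tour_region (adjacent_C_detour D\<^sub>C))"
    by (rule disjoint_routes_insert[OF _ route_adjacent_C_detour[OF D\<^sub>C assms]])
      (use adj \<open>C \<noteq> C'\<close> D\<^sub>B D\<^sub>C in \<open>auto simp: B_detour_def adjacent_C_detour_def fan_region_def
        fan_tour_def detour_word_def dest: nbr_ne_A\<close>)
  from wide_dist_le_if_disjoint_routes[OF this] show ?thesis
    using words \<open>C \<noteq> C'\<close> by simp
qed

lemma wide_dist_v2: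
  assumes "u \<noteq> v\<^sub>2" "differ_one A A' \<Longrightarrow> C \<noteq> C' \<or> B = B'"
  shows "wide_dist V E3C_E (2 * r + 2) u v\<^sub>2 \<le> enat k"
  using assms wide_dist_v2_if_not_adjacent wide_dist_v2_if_edge
    wide_dist_v2_if_adjacent_words by metis

subsection \<open>Targets in layer 1\<close>

text \<open>The cases \<open>P = A\<close> and \<open>Q = B'\<close> stand for the layer changes at the two ends. Tours for
  different \<open>P\<close> and different \<open>Q\<close> are disjoint, so a matching of closed neighbourhoods gives all
  routes but one.\<close>
definition matched_tour :: "nat list \<Rightarrow> nat list \<Rightarrow> e3c_vertex list" where
  "matched_tour P Q = (if P = A then [] else [(P, B, C, 2)])
     @ [(P, B, C, 1), (P, Q, C, 1), (P, Q, C, 0), (P, Q, C', 0), (P, Q, C', 2), (A', Q, C', 2)]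
     @ (if Q = B' then [] else [(A', Q, C', 1)])"

lemma route_matched_tour:
  assumes P: "P \<in> closed_nbrs r A" and Q: "Q \<in> closed_nbrs s B'"
    and ne: "C \<noteq> C' \<or> (P \<noteq> A' \<and> Q \<noteq> B)"
  shows "route V E3C_E k u v\<^sub>1 (tour_region (matched_tour P Q))"
proof (rule route_tour)
  have PQ: "P \<in> tern_words r" "Q \<in> tern_words s" using P Q closed_nbrs_subset A B' by auto
  have nbr: "P \<noteq> A \<Longrightarrow> differ_one A P" "Q \<noteq> B' \<Longrightarrow> differ_one Q B'"
    using differ_one_if_closed_nbr P Q differ_one_sym by blast+
  show "set (matched_tour P Q) \<subseteq> V" using words PQ by (auto simp: matched_tour_def)
  show "E3C_E u (hd (matched_tour P Q))"
    using nbr(1) by (simp add: matched_tour_def E3C_E_A E3C_E_layer)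
  show "E3C_E (last (matched_tour P Q)) v\<^sub>1"
    using nbr(2) by (simp add: matched_tour_def E3C_E_B E3C_E_layer del: One_nat_def)
  show "u \<notin> tour_region (matched_tour P Q)" "v\<^sub>1 \<notin> tour_region (matched_tour P Q)"
    using ne by (auto simp: matched_tour_def)
  show "tour_length (matched_tour P Q) + 2 \<le> k"
    using hamming_le_tern_words[OF B, of Q] hamming_le_tern_words[OF C, of C']
      hamming_le_tern_words[OF PQ(1), of A'] by (auto simp: matched_tour_def)
qed (simp_all add: matched_tour_def)

lemma matched_tour_disjoint:
  assumes "P \<noteq> P'" "Q \<noteq> Q'"
    and "C \<noteq> C' \<or> (P \<noteq> A' \<and> Q \<noteq> B \<and> P' \<noteq> A' \<and> Q' \<noteq> B)"
  shows "tour_region (matched_tour P Q) \<inter> tour_region (matched_tour P' Q') = {}"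
  using assms by (auto simp: matched_tour_def)

lemma matched_tour_C_detour_disjoint:
  assumes "D \<noteq> C" "D \<noteq> C'" "(P, Q) \<noteq> (A, B)" "(P, Q) \<noteq> (A', B')"
  shows "tour_region (matched_tour P Q) \<inter> tour_region (C_detour D) = {}"
  using assms by (auto simp: matched_tour_def C_detour_def)

definition matched_region :: "(nat list \<times> nat list) set \<Rightarrow> e3c_vertex set" where
  "matched_region M = (\<Union>x\<in>M. tour_region (matched_tour (fst x) (snd x)))"

lemma disjoint_routes_matched_region:
  assumes M: "matching M" "M \<subseteq> closed_nbrs r A \<times> closed_nbrs s B'"
    and ne: "\<And>P Q. (P, Q) \<in> M \<Longrightarrow> (P, Q) \<noteq> (A, B) \<and> (P, Q) \<noteq> (A', B')"
      "\<And>P Q. (P, Q) \<in> M \<Longrightarrow> C = C' \<Longrightarrow> P \<noteq> A' \<and> Q \<noteq> B"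
    and D: "detour_word t C C' D"
  shows "disjoint_routes V E3C_E k u v\<^sub>1 (Suc (card M))
    (matched_region M \<union> tour_region (C_detour D))"
proof (rule disjoint_routes_insert)
  show "disjoint_routes V E3C_E k u v\<^sub>1 (card M) (matched_region M)"
    unfolding matched_region_def
  proof (rule disjoint_routes_UNION)
    show "finite M" using M(1) by (simp add: matching_def)
    show "route V E3C_E k u v\<^sub>1 (tour_region (matched_tour (fst x) (snd x)))" if "x \<in> M" for x
      using that M(2) ne(2)[of "fst x" "snd x"] by (intro route_matched_tour) auto
    show "tour_region (matched_tour (fst x) (snd x))
        \<inter> tour_region (matched_tour (fst y) (snd y)) = {}"
      if "x \<in> M" "y \<in> M" "x \<noteq> y" for x y
    proof (rule matched_tour_disjoint)
      show "fst x \<noteq> fst y" "snd x \<noteq> snd y"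
        using that M(1) by (auto simp: matching_def inj_on_eq_iff)
      show "C \<noteq> C' \<or> (fst x \<noteq> A' \<and> snd x \<noteq> B \<and> fst y \<noteq> A' \<and> snd y \<noteq> B)"
        using that ne(2)[of "fst x" "snd x"] ne(2)[of "fst y" "snd y"] by auto
    qed
  qed
  show "route V E3C_E k u v\<^sub>1 (tour_region (C_detour D))" using D by (rule route_C_detour) simp
  have "tour_region (matched_tour (fst x) (snd x)) \<inter> tour_region (C_detour D) = {}" if "x \<in> M" for x
    using that ne(1)[of "fst x" "snd x"] D
    by (intro matched_tour_C_detour_disjoint) (auto simp: detour_word_def)
  then show "tour_region (C_detour D) \<inter> matched_region M = {}" unfolding matched_region_def by blast
qed

lemma wide_dist_v1_if_matching:
  assumes M: "matching M" "M \<subseteq> closed_nbrs r A \<times> closed_nbrs s B'"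
    and ne: "\<And>P Q. (P, Q) \<in> M \<Longrightarrow> (P, Q) \<noteq> (A, B) \<and> (P, Q) \<noteq> (A', B')"
      "\<And>P Q. (P, Q) \<in> M \<Longrightarrow> C = C' \<Longrightarrow> P \<noteq> A' \<and> Q \<noteq> B"
  shows "wide_dist V E3C_E (Suc (card M)) u v\<^sub>1 \<le> enat k"
proof -
  obtain D where "detour_word t C C' D" using ex_detour_word[OF C C' pos(2)] ..
  from wide_dist_le_if_disjoint_routes[OF disjoint_routes_matched_region[OF M ne this]]
  show ?thesis using words by simp
qed

lemma wide_dist_v1_if_distinct:
  assumes m: "1 \<le> m" "m \<le> r" "m \<le> s" and "C \<noteq> C'"
  shows "wide_dist V E3C_E (2 * m + 2) u v\<^sub>1 \<le> enat k"
proof -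
  have "A \<in> closed_nbrs r A" "B' \<in> closed_nbrs s B'" by (simp_all add: closed_nbrs_def)
  moreover have "3 \<le> Suc (2 * m)" "Suc (2 * m) \<le> card (closed_nbrs r A)"
      "Suc (2 * m) \<le> card (closed_nbrs s B')"
    using m card_closed_nbrs A B' by auto
  ultimately obtain M where M: "M \<subseteq> closed_nbrs r A \<times> closed_nbrs s B'" "matching M"
      "card M = Suc (2 * m)" "(A, B) \<notin> M" "(A', B') \<notin> M"
    by (rule obtain_matching_avoiding)
  have "wide_dist V E3C_E (Suc (card M)) u v\<^sub>1 \<le> enat k"
    by (rule wide_dist_v1_if_matching[OF M(2,1)]) (use M(4,5) \<open>C \<noteq> C'\<close> in auto)
  then show ?thesis using M(3) by simp
qed

lemma wide_dist_v1_if_distant: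
  assumes m: "m \<le> r" "m \<le> s" and "A' \<notin> closed_nbrs r A" "B \<notin> closed_nbrs s B'"
  shows "wide_dist V E3C_E (2 * m + 2) u v\<^sub>1 \<le> enat k"
proof -
  have "Suc (2 * m) \<le> card (closed_nbrs r A)" "Suc (2 * m) \<le> card (closed_nbrs s B')"
    using m card_closed_nbrs A B' by auto
  then obtain M where M: "M \<subseteq> closed_nbrs r A \<times> closed_nbrs s B'" "matching M"
      "card M = Suc (2 * m)"
    by (rule obtain_matching)
  have "wide_dist V E3C_E (Suc (card M)) u v\<^sub>1 \<le> enat k"
    by (rule wide_dist_v1_if_matching[OF M(2,1)]) (use M(1) assms(3,4) in auto)
  then show ?thesis using M(3) by simp
qed

text \<open>If \<open>C = C'\<close> and \<open>A'\<close> is in the closed neighbourhood of \<open>A\<close>, the matching has to avoid \<open>A'\<close>.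
  The route lost is replaced by one that leaves \<open>C\<close> unchanged and meets the closed neighbourhood of
  \<open>B'\<close> only in \<open>Q\<close>, which the matching avoids as well.\<close>
definition direct_tour :: "nat list \<Rightarrow> e3c_vertex list" where
  "direct_tour Q = (if A = A' then [] else [(A', B, C, 2)])
     @ (if B = B' then [] else [(A', B, C, 1), (A', Q, C, 1)])"

lemma route_direct_tour:
  assumes "C = C'" "A' \<in> closed_nbrs r A" "(A, B) \<noteq> (A', B')"
    and Q: "Q \<in> closed_nbrs s B'" "B = B' \<longleftrightarrow> Q = B'"
      "hamming_interval B Q \<inter> closed_nbrs s B' \<subseteq> {Q}"
  shows "route V E3C_E k u v\<^sub>1 (tour_region (direct_tour Q))"
proof (rule route_tour)
  have Q_word: "Q \<in> tern_words s" using closed_nbrs_subset[OF B'] Q(1) by blast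
  have A_nbr: "differ_one A A'" if "A \<noteq> A'" using differ_one_if_closed_nbr[OF assms(2)] that by simp
  have Q_nbr: "differ_one Q B'" if "B \<noteq> B'"
    using differ_one_if_closed_nbr[OF Q(1)] Q(2) that differ_one_sym by simp
  show "E3C_E u (hd (direct_tour Q))"
    using A_nbr assms(3) unfolding direct_tour_def by (auto simp: E3C_E_A E3C_E_layer)
  show "E3C_E (last (direct_tour Q)) v\<^sub>1"
    using Q_nbr assms(1,3) unfolding direct_tour_def
    by (auto simp: E3C_E_B E3C_E_layer simp del: One_nat_def)
  have "B' \<notin> hamming_interval B Q" if "B \<noteq> B'"
    using Q(2,3) that by (auto simp: closed_nbrs_def)
  then show "v\<^sub>1 \<notin> tour_region (direct_tour Q)" using Q(2) by (auto simp: direct_tour_def)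
  show "set (direct_tour Q) \<subseteq> V" using words Q_word by (auto simp: direct_tour_def)
  show "tour_length (direct_tour Q) + 2 \<le> k"
    using hamming_le_tern_words[OF B, of Q] by (simp add: direct_tour_def)
qed (use assms(3) in \<open>auto simp: direct_tour_def\<close>)

lemma direct_tour_matched_tour_disjoint:
  assumes "Q \<in> tern_words s" "P \<noteq> A'" "Q' \<notin> hamming_interval B Q"
  shows "tour_region (direct_tour Q) \<inter> tour_region (matched_tour P Q') = {}"
proof -
  have "B \<in> hamming_interval B Q" "Q \<in> hamming_interval B Q"
    using B assms(1)
    by (simp_all add: left_in_hamming_interval right_in_hamming_interval length_tern_words)
  then have "Q' \<noteq> B" "Q' \<noteq> Q" using assms(3) by auto
  then show ?thesis using assms(2,3) by (auto simp: direct_tour_def matched_tour_def)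
qed

lemma direct_tour_C_detour_disjoint:
  "D \<noteq> C \<Longrightarrow> D \<noteq> C' \<Longrightarrow> tour_region (direct_tour Q) \<inter> tour_region (C_detour D) = {}"
  by (auto simp: direct_tour_def C_detour_def)

lemma direct_tour_matched_region_disjoint:
  assumes "Q \<in> tern_words s" "\<And>P Q'. (P, Q') \<in> M \<Longrightarrow> P \<noteq> A' \<and> Q' \<notin> hamming_interval B Q"
  shows "tour_region (direct_tour Q) \<inter> matched_region M = {}"
proof -
  have "tour_region (direct_tour Q) \<inter> tour_region (matched_tour (fst x) (snd x)) = {}"
    if "x \<in> M" for x
    using that assms(2)[of "fst x" "snd x"]
    by (intro direct_tour_matched_tour_disjoint[OF assms(1)]) auto
  then show ?thesis unfolding matched_region_def by blast
qed

lemma wide_dist_v1_if_close: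
  assumes m: "m \<le> r" "m \<le> s" and "C = C'" and A'_nbr: "A' \<in> closed_nbrs r A"
  shows "wide_dist V E3C_E (2 * m + 2) u v\<^sub>1 \<le> enat k"
proof -
  obtain Q where Q: "Q \<in> closed_nbrs s B'" "B = B' \<longleftrightarrow> Q = B'"
      "hamming_interval B Q \<inter> closed_nbrs s B' \<subseteq> {Q}"
    using obtain_first_closed_nbr[OF B B'] .
  have Q_word: "Q \<in> tern_words s" using closed_nbrs_subset[OF B'] Q(1) by blast
  obtain D where D: "detour_word t C C' D" using ex_detour_word[OF C C' pos(2)] ..
  have "2 * m \<le> card (closed_nbrs r A - {A'})" "2 * m \<le> card (closed_nbrs s B' - {Q})"
    using m card_closed_nbrs A B' A'_nbr Q(1) by auto
  then obtain M where M: "M \<subseteq> (closed_nbrs r A - {A'}) \<times> (closed_nbrs s B' - {Q})" "matching M"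
      "card M = 2 * m"
    by (rule obtain_matching)
  have off: "P \<noteq> A' \<and> Q' \<notin> hamming_interval B Q" if "(P, Q') \<in> M" for P Q'
    using that M(1) Q(3) by auto
  then have "Q' \<noteq> B" if "(P, Q') \<in> M" for P Q' using that left_in_hamming_interval by metis
  then have routes: "disjoint_routes V E3C_E k u v\<^sub>1 (Suc (card M))
      (matched_region M \<union> tour_region (C_detour D))"
    by (intro disjoint_routes_matched_region M D) (use off M(1) in auto)
  show ?thesis
  proof (cases "(A, B) = (A', B')")
    case True
    then have "E3C_E u v\<^sub>1" using \<open>C = C'\<close> by (simp add: E3C_E_layer)
    from wide_dist_le_if_disjoint_routes_edge[OF routes _ _ _ this] show ?thesis
      using words M(3) by simp
  next
    case False
    have "tour_region (direct_tour Q) \<inter> (matched_region M \<union> tour_region (C_detour D)) = {}"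
      using direct_tour_matched_region_disjoint[OF Q_word off] direct_tour_C_detour_disjoint[of D Q] D
      unfolding detour_word_def by blast
    from disjoint_routes_insert[OF routes route_direct_tour[OF \<open>C = C'\<close> A'_nbr False Q] this]
    show ?thesis using wide_dist_le_if_disjoint_routes words M(3) by fastforce
  qed
qed

lemma wide_dist_v1:
  assumes "1 \<le> m" "m \<le> r" "m \<le> s" "C \<noteq> C' \<or> A' \<in> closed_nbrs r A \<or> B \<notin> closed_nbrs s B'"
  shows "wide_dist V E3C_E (2 * m + 2) u v\<^sub>1 \<le> enat k"
  using assms wide_dist_v1_if_distinct wide_dist_v1_if_distant wide_dist_v1_if_close by metis

end

section \<open>The upper bound\<close>

fun swap_AB :: "e3c_vertex \<Rightarrow> e3c_vertex" where
  "swap_AB (A, B, C, d) = (B, A, C, if d = 1 then 2 else if d = 2 then 1 else d)"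

fun swap_BC :: "e3c_vertex \<Rightarrow> e3c_vertex" where
  "swap_BC (A, B, C, d) = (A, C, B, if d = 0 then 1 else if d = 1 then 0 else d)"

lemma swap_AB_swap_AB [simp]: "swap_AB (swap_AB x) = x"
  by (cases x) auto

lemma swap_BC_swap_BC [simp]: "swap_BC (swap_BC x) = x"
  by (cases x) auto

lemma swap_AB_in_E3C_V: "x \<in> E3C_V r s t \<Longrightarrow> swap_AB x \<in> E3C_V s r t"
  by (cases x) auto

lemma swap_BC_in_E3C_V: "x \<in> E3C_V r s t \<Longrightarrow> swap_BC x \<in> E3C_V r t s"
  by (cases x) auto

lemma E3C_E_swap_AB: "E3C_E x y \<Longrightarrow> E3C_E (swap_AB x) (swap_AB y)"
  by (cases x, cases y) (auto simp: E3C_E_def split: if_splits)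

lemma E3C_E_swap_BC: "E3C_E x y \<Longrightarrow> E3C_E (swap_BC x) (swap_BC y)"
  by (cases x, cases y) (auto simp: E3C_E_def split: if_splits)

lemma wide_dist_le_swap_AB:
  "wide_dist (E3C_V r s t) E3C_E n x y \<le> wide_dist (E3C_V s r t) E3C_E n (swap_AB x) (swap_AB y)"
  by (rule wide_dist_le_involution) (auto intro: swap_AB_in_E3C_V E3C_E_swap_AB)

lemma wide_dist_le_swap_BC:
  "wide_dist (E3C_V r s t) E3C_E n x y \<le> wide_dist (E3C_V r t s) E3C_E n (swap_BC x) (swap_BC y)"
  by (rule wide_dist_le_involution) (auto intro: swap_BC_in_E3C_V E3C_E_swap_BC)

definition widely_linked ::
    "nat \<Rightarrow> nat \<Rightarrow> nat \<Rightarrow> nat \<Rightarrow> e3c_vertex \<Rightarrow> e3c_vertex \<Rightarrow> bool" where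
  "widely_linked m r s t x y \<longleftrightarrow>
     wide_dist (E3C_V r s t) E3C_E (2 * m + 2) x y \<le> enat (r + s + t + 6)"

lemma widely_linked_antimono: "widely_linked n r s t x y \<Longrightarrow> m \<le> n \<Longrightarrow> widely_linked m r s t x y"
  unfolding widely_linked_def by (erule order_trans[rotated]) (simp add: wide_dist_mono)

lemma widely_linked_sym: "widely_linked m r s t x y \<Longrightarrow> widely_linked m r s t y x"
  using wide_dist_commute[of E3C_E _ _ x y, OF E3C_E_sym] by (simp add: widely_linked_def)

lemma widely_linked_swap_AB:
  "widely_linked m s r t (swap_AB x) (swap_AB y) \<Longrightarrow> widely_linked m r s t x y"
  unfolding widely_linked_def
  by (rule order_trans[OF wide_dist_le_swap_AB]) (simp add: add.commute)

lemma widely_linked_swap_BC: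
  "widely_linked m r t s (swap_BC x) (swap_BC y) \<Longrightarrow> widely_linked m r s t x y"
  unfolding widely_linked_def
  by (rule order_trans[OF wide_dist_le_swap_BC]) (simp add: add_ac)

lemma widely_linked_2_2:
  assumes m: "1 \<le> m" "m \<le> r" "m \<le> s" "m \<le> t"
    and u: "(A, B, C, 2) \<in> E3C_V r s t" and v: "(A', B', C', 2) \<in> E3C_V r s t"
    and ne: "(A, B, C, 2) \<noteq> (A', B', C', 2::nat)"
  shows "widely_linked m r s t (A, B, C, 2) (A', B', C', 2)"
proof -
  have "widely_linked r r s t (A, B, C, 2) (A', B', C', 2)"
  proof (cases "C \<noteq> C' \<or> B = B'")
    case True
    interpret E3C_pair r s t A B C A' B' C' using m u v by unfold_locales auto
    show ?thesis unfolding widely_linked_def by (rule wide_dist_v2) (use True ne in auto)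
  next
    case False
    interpret E3C_pair r t s A C B A' C' B' using m u v by unfold_locales auto
    have linked: "widely_linked r r t s (A, C, B, 2) (A', C', B', 2)"
      unfolding widely_linked_def by (rule wide_dist_v2) (use False in auto)
    show ?thesis by (rule widely_linked_swap_BC) (use linked in simp)
  qed
  then show ?thesis using m(2) by (rule widely_linked_antimono)
qed

lemma widely_linked_2_1:
  assumes m: "1 \<le> m" "m \<le> r" "m \<le> s" "m \<le> t"
    and u: "(A, B, C, 2) \<in> E3C_V r s t" and v: "(A', B', C', 1) \<in> E3C_V r s t"
  shows "widely_linked m r s t (A, B, C, 2) (A', B', C', 1)"
proof (cases "C \<noteq> C' \<or> A' \<in> closed_nbrs r A \<or> B \<notin> closed_nbrs s B'")
  case True
  interpret E3C_pair r s t A B C A' B' C' using m u v by unfold_locales auto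
  show ?thesis unfolding widely_linked_def using m True by (intro wide_dist_v1)
next
  case False
  interpret E3C_pair s r t B' A' C' B A C using m u v by unfold_locales auto
  have linked: "widely_linked m s r t (B', A', C', 2) (B, A, C, 1)"
    unfolding widely_linked_def using m False by (intro wide_dist_v1) auto
  have "widely_linked m r s t (A', B', C', 1) (A, B, C, 2)"
    by (rule widely_linked_swap_AB) (use linked in simp)
  then show ?thesis by (rule widely_linked_sym)
qed

lemma widely_linked_from_2:
  assumes m: "1 \<le> m" "m \<le> r" "m \<le> s" "m \<le> t"
    and u: "(A, B, C, 2) \<in> E3C_V r s t" and v: "v \<in> E3C_V r s t" and ne: "(A, B, C, 2) \<noteq> v"
  shows "widely_linked m r s t (A, B, C, 2) v"
proof -
  obtain A' B' C' d' where v': "v = (A', B', C', d')" by (cases v)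
  with v consider (layer_2) "d' = 2" | (layer_1) "d' = 1" | (layer_0) "d' = 0" by auto
  then show ?thesis
  proof cases
    case layer_2
    then show ?thesis using widely_linked_2_2[OF m u] v ne unfolding v' by simp
  next
    case layer_1
    then show ?thesis using widely_linked_2_1[OF m u] v unfolding v' by simp
  next
    case layer_0
    have linked: "widely_linked m r t s (A, C, B, 2) (A', C', B', 1)"
      using m u v by (intro widely_linked_2_1) (auto simp: v')
    show ?thesis by (rule widely_linked_swap_BC) (use linked in \<open>simp add: v' layer_0\<close>)
  qed
qed

lemma widely_linked_from_1:
  assumes m: "1 \<le> m" "m \<le> r" "m \<le> s" "m \<le> t"
    and u: "(A, B, C, 1) \<in> E3C_V r s t" and v: "v \<in> E3C_V r s t" and ne: "(A, B, C, 1) \<noteq> v"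
  shows "widely_linked m r s t (A, B, C, 1) v"
proof (rule widely_linked_swap_AB)
  have "(B, A, C, 2) \<noteq> swap_AB v" using ne by (cases v) auto
  then have "widely_linked m s r t (B, A, C, 2) (swap_AB v)"
    using m u swap_AB_in_E3C_V[OF v] by (intro widely_linked_from_2) auto
  then show "widely_linked m s r t (swap_AB (A, B, C, 1)) (swap_AB v)" by simp
qed

lemma widely_linked_from_0:
  assumes m: "1 \<le> m" "m \<le> r" "m \<le> s" "m \<le> t"
    and u: "(A, B, C, 0) \<in> E3C_V r s t" and v: "v \<in> E3C_V r s t" and ne: "(A, B, C, 0) \<noteq> v"
  shows "widely_linked m r s t (A, B, C, 0) v"
proof (rule widely_linked_swap_BC)
  have "(A, C, B, 1) \<noteq> swap_BC v" using ne by (cases v) auto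
  then have "widely_linked m r t s (A, C, B, 1) (swap_BC v)"
    using m u swap_BC_in_E3C_V[OF v] by (intro widely_linked_from_1) auto
  then show "widely_linked m r t s (swap_BC (A, B, C, 0)) (swap_BC v)" by simp
qed

lemma E3C_wide_diam_le:
  assumes m: "1 \<le> m" "m \<le> r" "m \<le> s" "m \<le> t"
  shows "wide_diam (E3C_V r s t) E3C_E (2 * m + 2) \<le> enat (r + s + t + 6)"
proof (rule wide_diam_leI)
  fix u v assume u: "u \<in> E3C_V r s t" and v: "v \<in> E3C_V r s t" "u \<noteq> v"
  obtain A B C d where u': "u = (A, B, C, d)" by (cases u)
  with u consider (layer_2) "d = 2" | (layer_1) "d = 1" | (layer_0) "d = 0" by auto
  then have "widely_linked m r s t u v"
  proof cases
    case layer_2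
    show ?thesis using widely_linked_from_2[OF m] u v unfolding u' layer_2 .
  next
    case layer_1
    show ?thesis using widely_linked_from_1[OF m] u v unfolding u' layer_1 .
  next
    case layer_0
    show ?thesis using widely_linked_from_0[OF m] u v unfolding u' layer_0 .
  qed
  then show "wide_dist (E3C_V r s t) E3C_E (2 * m + 2) u v \<le> enat (r + s + t + 6)"
    by (simp only: widely_linked_def)
qed

section \<open>The lower bound\<close>

text \<open>A lower bound for the distance to \<open>(A', B', C', 2)\<close>: the summand that is added to the Hamming
  distances counts the layer changes that are still needed.\<close>
fun E3C_potential :: "nat list \<Rightarrow> nat list \<Rightarrow> nat list \<Rightarrow> e3c_vertex \<Rightarrow> nat" where
  "E3C_potential A' B' C' (A, B, C, d) = hamming A A' + hamming B B' + hamming C C' +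
     (if d = 2 then (if B = B' \<and> C = C' then 0 else if B = B' \<or> C = C' then 2 else 3)
      else if d = 1 then (if C = C' then 1 else 2)
      else (if B = B' then 1 else 2))"

lemma E3C_potential_step:
  assumes "E3C_E x y" "x \<in> E3C_V r s t" "y \<in> E3C_V r s t"
  shows "E3C_potential A' B' C' x \<le> Suc (E3C_potential A' B' C' y)"
proof -
  obtain A B C d where x: "x = (A, B, C, d)" by (cases x)
  obtain A\<^sub>1 B\<^sub>1 C\<^sub>1 d\<^sub>1 where y: "y = (A\<^sub>1, B\<^sub>1, C\<^sub>1, d\<^sub>1)" by (cases y)
  have d: "d \<in> {0, 1, 2}" "d\<^sub>1 \<in> {0, 1, 2}" using assms x y by auto
  from assms(1) consider (layer) "A = A\<^sub>1" "B = B\<^sub>1" "C = C\<^sub>1" "d \<noteq> d\<^sub>1"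
    | (C) "d = 0" "d\<^sub>1 = 0" "A = A\<^sub>1" "B = B\<^sub>1" "differ_one C C\<^sub>1"
    | (B) "d = 1" "d\<^sub>1 = 1" "A = A\<^sub>1" "C = C\<^sub>1" "differ_one B B\<^sub>1"
    | (A) "d = 2" "d\<^sub>1 = 2" "B = B\<^sub>1" "C = C\<^sub>1" "differ_one A A\<^sub>1"
    unfolding E3C_E_def x y by auto
  then show ?thesis
  proof cases
    case layer
    then show ?thesis using d unfolding x y by auto
  next
    case C
    then show ?thesis using hamming_le_Suc_if_differ_one[of C C\<^sub>1 C'] unfolding x y by auto
  next
    case B
    then show ?thesis using hamming_le_Suc_if_differ_one[of B B\<^sub>1 B'] unfolding x y by auto
  next
    case A
    then show ?thesis using hamming_le_Suc_if_differ_one[of A A\<^sub>1 A'] unfolding x y by auto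
  qed
qed

context E3C_pair
begin

lemma nbrs_u:
  "{y \<in> V. E3C_E u y} = (\<lambda>P. (P, B, C, 2)) ` nbrs r A \<union> {(A, B, C, 0), (A, B, C, 1)}"
  using words by (auto simp: E3C_E_def nbrs_def)

lemma finite_nbrs_u: "finite {y \<in> V. E3C_E u y}"
  unfolding nbrs_u by simp

lemma card_nbrs_u: "card {y \<in> V. E3C_E u y} = 2 * r + 2"
proof -
  have "card ((\<lambda>P. (P, B, C, 2::nat)) ` nbrs r A) = 2 * r"
    using card_nbrs[OF A] by (simp add: card_image inj_on_def)
  then show ?thesis unfolding nbrs_u by (subst card_Un_disjoint) auto
qed

lemma gdist_faulty_neighbourhood_ge:
  assumes far: "hamming P A' = r" "hamming B B' = s" "hamming C C' = t"
  defines "F \<equiv> {y \<in> V. E3C_E u y} - {(P, B, C, 2)}"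
  shows "enat (r + s + t + 4) \<le> gdist (V - F) E3C_E u v\<^sub>2"
proof -
  let ?w = "(P, B, C, 2::nat)" and ?h = "E3C_potential A' B' C'"
  have "B \<noteq> B'" "C \<noteq> C'" using far(2,3) pos by auto
  then have "?h ?w = r + s + t + 3" "?h v\<^sub>2 = 0" "u \<noteq> v\<^sub>2" using far by simp_all
  moreover have "enat (?h ?w) \<le> gdist (V - F) E3C_E ?w v\<^sub>2 + enat (?h v\<^sub>2)"
  proof (rule potential_le_gdist)
    fix x y assume "x \<in> V - F" "y \<in> V - F" "E3C_E x y"
    then have "?h x \<le> Suc (?h y)" using E3C_potential_step[of x y r s t] by blast
    then show "enat (?h x) \<le> eSuc (enat (?h y))" by (simp add: eSuc_enat)
  qed
  ultimately have "enat (r + s + t + 3) \<le> gdist (V - F) E3C_E ?w v\<^sub>2" by (simp flip: zero_enat_def)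
  moreover have "enat (r + s + t + 4) = eSuc (enat (r + s + t + 3))" by (simp add: eSuc_enat)
  ultimately have "enat (r + s + t + 4) \<le> eSuc (gdist (V - F) E3C_E ?w v\<^sub>2)" by simp
  also have "\<dots> \<le> gdist (V - F) E3C_E u v\<^sub>2"
    by (rule gdist_via_sole_neighbour_le) (use \<open>u \<noteq> v\<^sub>2\<close> in \<open>auto simp: F_def\<close>)
  finally show ?thesis .
qed

lemma fault_diam_ge:
  assumes P: "P \<in> nbrs r A"
    and far: "hamming P A' = r" "hamming B B' = s" "hamming C C' = t"
  shows "enat (r + s + t + 4) \<le> fault_diam V E3C_E (2 * r + 1)"
proof -
  let ?N = "{y \<in> V. E3C_E u y}"
  let ?F = "?N - {(P, B, C, 2)}"
  have "B \<noteq> B'" "C \<noteq> C'" using far(2,3) pos by auto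
  then have uv: "u \<in> V" "v\<^sub>2 \<in> V" "u \<noteq> v\<^sub>2" and F: "?F \<subseteq> V - {u, v\<^sub>2}" "finite ?F"
    using words finite_nbrs_u by (auto simp: E3C_E_def)
  have "(P, B, C, 2) \<in> ?N" unfolding nbrs_u using P by auto
  then have "card ?F = 2 * r + 1"
    using card_nbrs_u finite_nbrs_u by simp
  then have "gdist (V - ?F) E3C_E u v\<^sub>2 \<le> fault_diam V E3C_E (2 * r + 1)"
    unfolding fault_diam_def using uv F by (intro Sup_upper) blast
  with gdist_faulty_neighbourhood_ge[OF far] show ?thesis by (rule order_trans)
qed

end

lemma E3C_fault_diam_ge:
  assumes "1 \<le> r" "1 \<le> s" "1 \<le> t"
  shows "enat (r + s + t + 4) \<le> fault_diam (E3C_V r s t) E3C_E (2 * r + 1)"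
proof -
  let ?P = "(replicate r 0)[0 := 2 :: nat]"
  interpret E3C_pair r s t "replicate r 0" "replicate s 0" "replicate t 0"
    "replicate r 1" "replicate s 1" "replicate t 1"
    using assms by unfold_locales (auto simp: tern_words_def)
  have "?P \<in> nbrs r (replicate r 0)" using A assms(1) by (intro list_update_in_nbrs) auto
  moreover have "hamming ?P (replicate r 1) = r"
    using hamming_eq_length[of ?P "replicate r 1"] by (auto simp: nth_list_update)
  moreover have "hamming (replicate s 0) (replicate s (1::nat)) = s"
    using hamming_eq_length[of "replicate s 0" "replicate s (1::nat)"] by simp
  moreover have "hamming (replicate t 0) (replicate t (1::nat)) = t"
    using hamming_eq_length[of "replicate t 0" "replicate t (1::nat)"] by simp
  ultimately show ?thesis by (rule fault_diam_ge)
qed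

theorem theorem3:
  fixes r s t n :: nat
  assumes "1 \<le> r" and "r \<le> s" and "s \<le> t" and "n = r + s + t + 1"
  shows "enat (n + 3) = enat (r + s + t + 4)
       \<and> enat (r + s + t + 4) \<le> fault_diam (E3C_V r s t) E3C_E (2 * r + 1)
       \<and> fault_diam (E3C_V r s t) E3C_E (2 * r + 1) \<le> wide_diam (E3C_V r s t) E3C_E (2 * r + 2)
       \<and> wide_diam (E3C_V r s t) E3C_E (2 * r + 2) \<le> enat (r + s + t + 6)
       \<and> enat (r + s + t + 6) = enat (n + 5)"
proof (intro conjI)
  show "enat (r + s + t + 4) \<le> fault_diam (E3C_V r s t) E3C_E (2 * r + 1)"
    using assms by (intro E3C_fault_diam_ge) auto
  show "fault_diam (E3C_V r s t) E3C_E (2 * r + 1) \<le> wide_diam (E3C_V r s t) E3C_E (2 * r + 2)"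
    using fault_diam_le_wide_diam[of "E3C_V r s t" E3C_E "2 * r + 1"] by simp
  show "wide_diam (E3C_V r s t) E3C_E (2 * r + 2) \<le> enat (r + s + t + 6)"
    using assms by (intro E3C_wide_diam_le) auto
qed (use assms(4) in simp_all)

end
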